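(* Let $\mathcal{B}$ be an integer matrix that is $\mathcal{A}$-graded by $\phi$, such that the semigroup $\mathbb{N}\mathcal{B}^{\phi}$ is normal. Then $\sup_{r\ge 1}\operatorname{mardeg}\big(\times_{\mathcal{A}}^{r}\mathcal{B}\big)$ is finite.
   Context: $\mathbb{N}=\{0,1,\dots\}$. Let $\mathcal{A}\in\mathbb{Z}^{s\times t}$ be an integer matrix and $\mathcal{B}$ an integer matrix with $n$ columns $b_1,\dots,b_n$. A surjection $\phi:[n]\to[t]$ induces the linear map $\phi:\mathbb{Z}^n\to\mathbb{Z}^t$, $e_i\mapsto e_{\phi(i)}$. $\mathcal{B}$ is $\mathcal{A}$-graded by $\phi$ if $\phi(\ker_{\mathbb{Z}}\mathcal{B})\subseteq\ker_{\mathbb{Z}}\mathcal{A}$. The $r$-fold toric fiber power $\times_{\mathcal{A}}^{r}\mathcal{B}$ is the matrix whose columns are the stacked vectors $(b_{i_1};\dots;b_{i_r})$, one for each tuple $(i_1,\dots,i_r)\in[n]^r$ with $\phi(i_1)=\dots=\phi(i_r)$. $\mathcal{B}^{\phi}$ is the matrix with columns $\binom{b_i}{\phi(e_i)}$, $i=1,\dots,n$. For an integer matrix $M$, $\mathbb{N}M$, $\mathbb{Z}M$, $\mathbb{R}_{\ge}M$ denote the semigroup, lattice and cone generated by its columns; $\mathbb{N}M$ is normal if $\mathbb{N}M=\mathbb{Z}M\cap\mathbb{R}_{\ge}M$. A Markov basis of a matrix $M$ with $k$ columns is a set $\mathcal{M}\subseteq\mathbb{Z}^k$ such that for every integer vector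 $b$ the undirected graph on $\{v\in\mathbb{N}^k:Mv=b\}$, in which $u,v$ are adjacent iff $u-v\in\pm\mathcal{M}$, is connected. For $v=v^+-v^-$ (positive and negative part), $\deg(v)=\max\{\|v^+\|_1,\|v^-\|_1\}$, and $\deg(\mathcal{M})=\sup_{v\in\mathcal{M}}\deg(v)$. $\operatorname{mardeg}(M)$ is the minimum of $\deg(\mathcal{M})$ over all Markov bases $\mathcal{M}$ of $M$. *)

theory Defs
  imports "Jordan_Normal_Form.Matrix_Kernel" "HOL-Library.Extended_Nat"
begin

text \<open>Matrices are those of Jordan-Normal-Form, so index sets \<open>[n] = {1,...,n}\<close> become
  \<open>{..<n}\<close>, and a map \<open>[n] \<rightarrow> [t]\<close> is the restriction of a function on \<open>nat\<close> to \<open>{..<n}\<close>.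
  Matrices without rows or without columns are allowed.\<close>

subsection \<open>Gradings and toric fiber powers\<close>

text \<open>The matrix of the linear map \<open>\<int>\<^sup>n \<rightarrow> \<int>\<^sup>t\<close> with \<open>e\<^sub>i \<mapsto> e\<^bsub>\<phi>(i)\<^esub>\<close>.\<close>

definition index_map_mat :: "nat \<Rightarrow> nat \<Rightarrow> (nat \<Rightarrow> nat) \<Rightarrow> int mat" where
  "index_map_mat n t \<phi> = mat_of_cols t (map (\<lambda>i. unit_vec t (\<phi> i)) [0..<n])"

definition graded_by :: "int mat \<Rightarrow> int mat \<Rightarrow> (nat \<Rightarrow> nat) \<Rightarrow> bool" where
  "graded_by A B \<phi> \<longleftrightarrow>
     (\<lambda>v. index_map_mat (dim_col B) (dim_col A) \<phi> *\<^sub>v v) ` mat_kernel B \<subseteq> mat_kernel A"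

text \<open>The matrix \<open>\<B>\<^sup>\<phi>\<close>; the number \<open>t\<close> is the size of the codomain of \<open>\<phi>\<close>.\<close>

definition extend_by_grading :: "int mat \<Rightarrow> nat \<Rightarrow> (nat \<Rightarrow> nat) \<Rightarrow> int mat" where
  "extend_by_grading B t \<phi> =
     mat_of_cols (dim_row B + t)
       (map (\<lambda>i. col B i @\<^sub>v index_map_mat (dim_col B) t \<phi> *\<^sub>v unit_vec (dim_col B) i)
         [0..<dim_col B])"

text \<open>All tuples in \<open>[n]\<^sup>r\<close> with entries of equal \<open>\<phi>\<close>-value, each listed exactly once
  (in lexicographic order).\<close>

definition fiber_tuples :: "nat \<Rightarrow> nat \<Rightarrow> (nat \<Rightarrow> nat) \<Rightarrow> nat list list" where
  "fiber_tuples r n \<phi> =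
     filter (\<lambda>is. \<forall>i\<in>set is. \<forall>j\<in>set is. \<phi> i = \<phi> j) (List.n_lists r [0..<n])"

definition stacked_cols :: "int mat \<Rightarrow> nat list \<Rightarrow> int vec" where
  "stacked_cols B is = foldr (\<lambda>i v. col B i @\<^sub>v v) is (0\<^sub>v 0)"

text \<open>The matrix \<open>\<A>\<close> enters the toric fiber power \<open>\<times>\<^sub>\<A>\<^sup>r \<B>\<close> only through \<open>\<phi>\<close>.\<close>

definition toric_fiber_power :: "nat \<Rightarrow> int mat \<Rightarrow> (nat \<Rightarrow> nat) \<Rightarrow> int mat" where
  "toric_fiber_power r B \<phi> =
     mat_of_cols (r * dim_row B) (map (stacked_cols B) (fiber_tuples r (dim_col B) \<phi>))"

subsection \<open>Affine semigroups\<close>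

definition semigroup_of :: "int mat \<Rightarrow> int vec set" where
  "semigroup_of M = {M *\<^sub>v c |c. c \<in> carrier_vec (dim_col M) \<and> 0\<^sub>v (dim_col M) \<le> c}"

definition col_lattice :: "int mat \<Rightarrow> int vec set" where
  "col_lattice M = {M *\<^sub>v c |c. c \<in> carrier_vec (dim_col M)}"

definition cone_of :: "int mat \<Rightarrow> real vec set" where
  "cone_of M = {map_mat real_of_int M *\<^sub>v c |c. c \<in> carrier_vec (dim_col M) \<and> 0\<^sub>v (dim_col M) \<le> c}"

definition normal_semigroup :: "int mat \<Rightarrow> bool" where
  "normal_semigroup M \<longleftrightarrow>
     semigroup_of M = {v \<in> col_lattice M. map_vec real_of_int v \<in> cone_of M}"

subsection \<open>Markov bases\<close>

definition fiber :: "int mat \<Rightarrow> int vec \<Rightarrow> int vec set" where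
  "fiber M b = {v \<in> carrier_vec (dim_col M). 0\<^sub>v (dim_col M) \<le> v \<and> M *\<^sub>v v = b}"

definition fiber_edges :: "int mat \<Rightarrow> int vec \<Rightarrow> int vec set \<Rightarrow> (int vec \<times> int vec) set" where
  "fiber_edges M b S =
     {(u, v). u \<in> fiber M b \<and> v \<in> fiber M b \<and> u - v \<in> S \<union> uminus ` S}"

text \<open>An empty fiber counts as connected.\<close>

definition markov_basis :: "int mat \<Rightarrow> int vec set \<Rightarrow> bool" where
  "markov_basis M S \<longleftrightarrow>
     S \<subseteq> carrier_vec (dim_col M) \<and>
     (\<forall>b \<in> carrier_vec (dim_row M). \<forall>u \<in> fiber M b. \<forall>v \<in> fiber M b.
        (u, v) \<in> (fiber_edges M b S)\<^sup>*)"

definition pos_part :: "int vec \<Rightarrow> int vec" where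
  "pos_part v = map_vec (\<lambda>x. max x 0) v"

definition neg_part :: "int vec \<Rightarrow> int vec" where
  "neg_part v = map_vec (\<lambda>x. max (- x) 0) v"

definition one_norm :: "int vec \<Rightarrow> nat" where
  "one_norm v = nat (\<Sum>i<dim_vec v. \<bar>v $ i\<bar>)"

definition move_degree :: "int vec \<Rightarrow> nat" where
  "move_degree v = max (one_norm (pos_part v)) (one_norm (neg_part v))"

definition set_degree :: "int vec set \<Rightarrow> enat" where
  "set_degree S = (SUP v\<in>S. enat (move_degree v))"

text \<open>In \<open>enat\<close> the infimum of a nonempty set is its least element, and \<open>carrier_vec (dim_col M)\<close>
  is always a Markov basis of \<open>M\<close>, so the infimum below is a minimum.\<close>

definition mardeg :: "int mat \<Rightarrow> enat" where
  "mardeg M = (INF S\<in>{S. markov_basis M S}. set_degree S)"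

end

theory Submission
  imports Defs "HOL-Library.Multiset"
begin

text \<open>Call \<open>\<phi> x\<close> the grade of a column index \<open>x\<close>. A point of a fiber of the \<open>r\<close>-fold fiber power is a finite
multiset of rows of length \<open>r\<close>, all entries of a row having the same grade: a table. The matrix
sees a table only through the \<open>r\<close> multisets of column indices in its margins \<open>V\<^sub>1, ..., V\<^sub>r\<close>, and of
each \<open>V\<^sub>j\<close> it records the vector \<open>b\<^sub>j\<close> that is the sum of the columns of \<open>\<B>\<close> in \<open>V\<^sub>j\<close>. All margins
of a table have the same multiset of grades \<open>c\<close>.

Tables with equal margins are connected by swaps of two entries, which have degree 2
(\<open>connected_by_swaps\<close>), and any margins with a common multiset of grades come from a table
(\<open>table_with_margins\<close>). Hence a simultaneous change of all margins, in which every \<open>V\<^sub>j\<close> changes in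
at most \<open>D\<close> elements and the multiset of grades changes in the same way for all \<open>j\<close>, is achieved by
moves whose degree is bounded in terms of \<open>D\<close> and the number of grades, but not of \<open>r\<close>
(\<open>simultaneous_move\<close>): the changing parts of the margins can be enlarged to have the same grades.

It remains to go from margins \<open>V\<^sub>j\<close> with grades \<open>c\<close> to margins \<open>W\<^sub>j\<close> with grades \<open>c'\<close> by such
changes. If \<open>c = c'\<close>, Dickson's lemma splits every pair \<open>(V\<^sub>j, W\<^sub>j)\<close> into pairs from a finite set
(\<open>connected_by_equal_grades\<close>). If \<open>c \<noteq> c'\<close>, one first needs a short step from \<open>c\<close> towards \<open>c'\<close> that
is possible for all \<open>j\<close> at once. Here normality enters: the semigroup generated by the columns
\<open>(b, e)\<close> of \<open>\<B>\<^sup>\<phi>\<close> is the intersection of a lattice and a cone, and a finitely generated rational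
cone is cut out by finitely many integral functionals. The grades reachable over \<open>b\<^sub>j\<close> are therefore
the points of a coset of one fixed lattice that satisfy inequalities whose linear parts do not
depend on \<open>b\<^sub>j\<close>; only the constants do. By Dickson's lemma the lattice has a finite set of steps such
that every difference \<open>c' - c\<close> admits one which has at each functional the same sign as \<open>c' - c\<close>
and at most its absolute value (\<open>finite_conformal_steps\<close>, a Graver basis). Such a step preserves any
system of these inequalities that holds at both \<open>c\<close> and \<open>c'\<close>, hence all \<open>r\<close> systems. For each of the
finitely many steps, Dickson's lemma bounds the change of a margin that realizes it
(\<open>uniform_lift_bound\<close>).\<close>

section \<open>Dickson's lemma and multisets\<close>

text \<open>Dickson's lemma, for an arbitrary set \<open>A\<close> on which finitely many natural-valued functions are
given. Induction on the number of functions: if \<open>B\<close> works for the others and \<open>N\<close> bounds the new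
function \<open>g\<close> on \<open>B\<close>, then \<open>B\<close> also works wherever \<open>g \<ge> N\<close>, and the rest of \<open>A\<close> splits into finitely
many level sets of \<open>g\<close>.\<close>

lemma dickson_finite_lower_set:
  fixes Fs :: "('a \<Rightarrow> nat) set"
  assumes "finite Fs"
  shows "\<exists>B\<subseteq>A. finite B \<and> (\<forall>a\<in>A. \<exists>b\<in>B. \<forall>f\<in>Fs. f b \<le> f a)"
  using assms
proof (induction Fs arbitrary: A rule: finite_induct)
  case empty
  show ?case
  proof (cases "A = {}")
    case False
    then obtain a where "a \<in> A" by blast
    then show ?thesis by (intro exI[of _ "{a}"]) auto
  qed auto
next
  case (insert g Fs)
  obtain B0 where B0: "B0 \<subseteq> A" "finite B0" "\<forall>a\<in>A. \<exists>b\<in>B0. \<forall>f\<in>Fs. f b \<le> f a"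
    using insert.IH[of A] by blast
  obtain N where N: "\<forall>b\<in>B0. g b \<le> N"
    using finite_nat_set_iff_bounded_le[of "g ` B0"] B0(2) by auto
  have "\<forall>k. \<exists>B\<subseteq>{a\<in>A. g a = k}. finite B \<and>
          (\<forall>a\<in>{a\<in>A. g a = k}. \<exists>b\<in>B. \<forall>f\<in>Fs. f b \<le> f a)"
    using insert.IH by blast
  then obtain Bk where "\<forall>k. Bk k \<subseteq> {a\<in>A. g a = k} \<and> finite (Bk k) \<and>
      (\<forall>a\<in>{a\<in>A. g a = k}. \<exists>b\<in>Bk k. \<forall>f\<in>Fs. f b \<le> f a)"
    by (rule choice[THEN exE])
  then have Bk: "\<And>k. Bk k \<subseteq> {a\<in>A. g a = k}" "\<And>k. finite (Bk k)"
      "\<And>k a. a \<in> A \<Longrightarrow> g a = k \<Longrightarrow> \<exists>b\<in>Bk k. \<forall>f\<in>Fs. f b \<le> f a"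
    by auto
  define B where "B = B0 \<union> (\<Union>k<N. Bk k)"
  have "\<exists>b\<in>B. \<forall>f\<in>insert g Fs. f b \<le> f a" if a: "a \<in> A" for a
  proof (cases "g a < N")
    case True
    obtain b where b: "b \<in> Bk (g a)" "\<forall>f\<in>Fs. f b \<le> f a" using Bk(3)[OF a refl] by blast
    then have "g b \<le> g a" using Bk(1) by force
    then show ?thesis using b True unfolding B_def by blast
  next
    case False
    obtain b where b: "b \<in> B0" "\<forall>f\<in>Fs. f b \<le> f a" using B0(3) a by blast
    moreover have "g b \<le> g a" using False N b(1) by fastforce
    ultimately show ?thesis unfolding B_def by blast
  qed
  moreover have "B \<subseteq> A" "finite B" using B0 Bk(1,2) unfolding B_def by blast+
  ultimately show ?case by blast
qed

lemma choose_pairs: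
  assumes "\<forall>j<r. \<exists>p q. P j p q"
  shows "\<exists>p q. \<forall>j<r. P j (p j) (q j)"
  using assms by metis

lemma multiset_pairs_bounded_below:
  fixes A :: "('a multiset \<times> 'b multiset) set"
  assumes "finite X" "finite Y"
    and "\<And>v w. (v, w) \<in> A \<Longrightarrow> set_mset v \<subseteq> X \<and> set_mset w \<subseteq> Y"
  shows "\<exists>D. \<forall>(v, w)\<in>A. \<exists>(p, q)\<in>A. p \<subseteq># v \<and> q \<subseteq># w \<and> size p \<le> D \<and> size q \<le> D"
proof -
  define Fs where "Fs = (\<lambda>x z :: 'a multiset \<times> 'b multiset. count (fst z) x) ` X
    \<union> (\<lambda>y z. count (snd z) y) ` Y"
  have "finite Fs" unfolding Fs_def using assms by auto
  from dickson_finite_lower_set[OF this, of A] obtain B where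
    B: "B \<subseteq> A" "finite B" "\<forall>a\<in>A. \<exists>b\<in>B. \<forall>f\<in>Fs. f b \<le> f a" by blast
  obtain D where D: "\<forall>b\<in>B. size (fst b) + size (snd b) \<le> D"
    using finite_nat_set_iff_bounded_le[of "(\<lambda>b. size (fst b) + size (snd b)) ` B"] B(2) by auto
  have "\<exists>(p, q)\<in>A. p \<subseteq># v \<and> q \<subseteq># w \<and> size p \<le> D \<and> size q \<le> D" if vw: "(v, w) \<in> A" for v w
  proof -
    obtain p q where pq: "(p, q) \<in> B" "\<forall>f\<in>Fs. f (p, q) \<le> f (v, w)" using B(3) vw by (metis surj_pair)
    have pqA: "(p, q) \<in> A" using pq(1) B(1) by blast
    have "count p x \<le> count v x" for x
    proof (cases "x \<in> X")
      case True
      then have "(\<lambda>z. count (fst z) x) \<in> Fs" by (auto simp: Fs_def)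
      then show ?thesis using pq(2) by force
    next
      case False
      then have "x \<notin># p" using assms(3)[OF pqA] by blast
      then show ?thesis by (simp add: not_in_iff)
    qed
    moreover have "count q x \<le> count w x" for x
    proof (cases "x \<in> Y")
      case True
      then have "(\<lambda>z. count (snd z) x) \<in> Fs" by (auto simp: Fs_def)
      then show ?thesis using pq(2) by force
    next
      case False
      then have "x \<notin># q" using assms(3)[OF pqA] by blast
      then show ?thesis by (simp add: not_in_iff)
    qed
    ultimately have "p \<subseteq># v" "q \<subseteq># w" by (auto simp: subseteq_mset_def)
    moreover have "size p \<le> D" "size q \<le> D" using D pq(1) by force+
    ultimately show ?thesis using pqA by blast
  qed
  then show ?thesis by blast
qed

text \<open>This is what enlarges the changing parts of different margins until their grades agree.\<close>

lemma submultiset_with_prescribed_image: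
  assumes "P \<subseteq># V" "image_mset f P \<subseteq># E" "E \<subseteq># image_mset f V"
  shows "\<exists>U. P \<subseteq># U \<and> U \<subseteq># V \<and> image_mset f U = E"
proof -
  obtain V' where V: "V = P + V'" using assms(1) by (metis subset_mset.le_iff_add)
  obtain E' where E: "E = image_mset f P + E'" using assms(2) by (metis subset_mset.le_iff_add)
  obtain F where "image_mset f V = E + F" using assms(3) by (metis subset_mset.le_iff_add)
  then have "image_mset f V' = E' + F" using V E by (simp add: add.assoc)
  then obtain U W where "V' = U + W" "E' = image_mset f U"
    using image_mset_eq_plusD by blast
  then show ?thesis using V E by (intro exI[of _ "P + U"]) auto
qed

abbreviation weight :: "('a \<Rightarrow> int) \<Rightarrow> 'a multiset \<Rightarrow> int" where
  "weight f V \<equiv> \<Sum>x\<in>#V. f x"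

section \<open>Tables and their margins\<close>

text \<open>\<open>X\<close> is the set of column indices, \<open>\<beta> i x\<close> is the entry of the matrix \<open>\<B>\<close> in row \<open>i\<close> and column \<open>x\<close>,
and \<open>\<phi> x\<close> is the grade of \<open>x\<close>.\<close>

locale graded_items =
  fixes X :: "'a set" and I :: "'i set" and \<beta> :: "'i \<Rightarrow> 'a \<Rightarrow> int" and \<phi> :: "'a \<Rightarrow> 'c"
  assumes finite_X: "finite X"
begin

definition equiv_items :: "'a multiset \<Rightarrow> 'a multiset \<Rightarrow> bool" where
  "equiv_items V W \<longleftrightarrow> (\<forall>i\<in>I. weight (\<beta> i) V = weight (\<beta> i) W)"

definition monochrome :: "nat \<Rightarrow> 'a list \<Rightarrow> bool" where
  "monochrome r \<rho> \<longleftrightarrow> length \<rho> = r \<and> (\<exists>c. \<forall>i<r. \<rho> ! i \<in> X \<and> \<phi> (\<rho> ! i) = c)"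

definition table :: "nat \<Rightarrow> 'a list multiset \<Rightarrow> bool" where
  "table r T \<longleftrightarrow> (\<forall>\<rho>\<in>#T. monochrome r \<rho>)"

definition margin :: "nat \<Rightarrow> 'a list multiset \<Rightarrow> 'a multiset" where
  "margin j T = image_mset (\<lambda>\<rho>. \<rho> ! j) T"

text \<open>A step is a move of degree at most \<open>d\<close>. The rows \<open>Z\<close> are kept, and the condition on the margins of the
exchanged rows says that both tables lie in the same fiber of the fiber power.\<close>

definition step :: "nat \<Rightarrow> nat \<Rightarrow> 'a list multiset \<Rightarrow> 'a list multiset \<Rightarrow> bool" where
  "step r d T T' \<longleftrightarrow> (\<exists>Z U U'. T = Z + U \<and> T' = Z + U' \<and> table r Z \<and> table r U \<and> table r U' \<and>
     size U \<le> d \<and> size U' \<le> d \<and> (\<forall>j<r. equiv_items (margin j U) (margin j U')))"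

abbreviation connected_by :: "nat \<Rightarrow> nat \<Rightarrow> 'a list multiset \<Rightarrow> 'a list multiset \<Rightarrow> bool" where
  "connected_by r d \<equiv> (step r d)\<^sup>*\<^sup>*"

lemma monochromeD:
  assumes "monochrome r \<rho>"
  shows "length \<rho> = r" "i < r \<Longrightarrow> \<rho> ! i \<in> X" "i < r \<Longrightarrow> \<phi> (\<rho> ! i) = \<phi> (\<rho> ! 0)"
  using assms unfolding monochrome_def by (auto, metis length_greater_0_conv list.size(3) not_less_zero)

lemma equiv_items_refl [simp]: "equiv_items V V"
  by (simp add: equiv_items_def)

lemma margin_plus [simp]: "margin j (T + T') = margin j T + margin j T'"
  by (simp add: margin_def)

lemma margin_empty [simp]: "margin j {#} = {#}"
  by (simp add: margin_def)

lemma size_margin [simp]: "size (margin j T) = size T"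
  by (simp add: margin_def)

lemma table_plus [simp]: "table r (T + T') \<longleftrightarrow> table r T \<and> table r T'"
  by (auto simp: table_def)

lemma table_empty [simp]: "table r {#}"
  by (simp add: table_def)

lemma table_margin:
  assumes "table r T" "j < r"
  shows "set_mset (margin j T) \<subseteq> X" "image_mset \<phi> (margin j T) = image_mset \<phi> (margin 0 T)"
  using assms by (auto simp: margin_def table_def monochrome_def image_mset.compositionality o_def
      intro!: image_mset_cong)

lemma stepI:
  assumes "table r Z" "table r U" "table r U'" "size U \<le> d" "size U' \<le> d"
    and "\<And>j. j < r \<Longrightarrow> equiv_items (margin j U) (margin j U')"
  shows "step r d (Z + U) (Z + U')"
  using assms unfolding step_def by blast

lemma step_add:
  assumes "step r d T T'" "table r Z"
  shows "step r d (Z + T) (Z + T')"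
proof -
  obtain Y U U' where *: "T = Y + U" "T' = Y + U'" "table r Y" "table r U" "table r U'"
      "size U \<le> d" "size U' \<le> d" "\<forall>j<r. equiv_items (margin j U) (margin j U')"
    using assms(1) unfolding step_def by blast
  have "step r d ((Z + Y) + U) ((Z + Y) + U')"
    by (rule stepI) (use *(3-) assms(2) in auto)
  then show ?thesis unfolding *(1,2) by (simp add: add.assoc)
qed

lemma connected_by_add:
  assumes "connected_by r d T T'" "table r Z"
  shows "connected_by r d (Z + T) (Z + T')"
  using assms(1)
  by (induction rule: rtranclp_induct) (auto intro: rtranclp.rtrancl_into_rtrancl step_add[OF _ assms(2)])

lemma connected_by_mono:
  assumes "connected_by r d T T'" "d \<le> d'"
  shows "connected_by r d' T T'"
proof -
  have "step r d' S S'" if st: "step r d S S'" for S S'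
  proof -
    obtain Y U U' where *: "S = Y + U" "S' = Y + U'" "table r Y" "table r U" "table r U'"
        "size U \<le> d" "size U' \<le> d" "\<forall>j<r. equiv_items (margin j U) (margin j U')"
      using st unfolding step_def by blast
    show ?thesis unfolding *(1,2) by (rule stepI) (use *(3-) assms(2) in auto)
  qed
  then show ?thesis using assms(1) mono_rtranclp[of "step r d" "step r d'"] by blast
qed

lemma connected_by_table: "connected_by r d T T' \<Longrightarrow> table r T \<Longrightarrow> table r T'"
  by (induction rule: rtranclp_induct) (auto simp: step_def)

lemma connected_by_equiv:
  "connected_by r d T T' \<Longrightarrow> j < r \<Longrightarrow> equiv_items (margin j T) (margin j T')"
  by (induction rule: rtranclp_induct) (auto simp: step_def equiv_items_def)

lemma swap_entries:
  assumes T: "table r T" and \<sigma>: "\<sigma> \<in># T" and \<tau>: "\<tau> \<in># T" and ne: "\<sigma> ! k \<noteq> \<tau> ! k"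
    and k: "k < r" and c: "\<phi> (\<sigma> ! k) = \<phi> (\<tau> ! k)"
  shows "\<exists>T'. step r 2 T T' \<and> (\<forall>j. j < r \<longrightarrow> margin j T' = margin j T) \<and> \<sigma>[k := \<tau> ! k] \<in># T'"
proof -
  have "\<sigma> \<noteq> \<tau>" using ne by blast
  obtain Z1 where "T = add_mset \<sigma> Z1" using \<sigma> by (metis insert_DiffM)
  moreover obtain Z where "Z1 = add_mset \<tau> Z"
    using \<tau> \<open>\<sigma> \<noteq> \<tau>\<close> calculation by (metis insert_noteq_member insert_DiffM)
  ultimately have TZ: "T = Z + {#\<sigma>, \<tau>#}" by simp
  define U' where "U' = {#\<sigma>[k := \<tau> ! k], \<tau>[k := \<sigma> ! k]#}"
  have rows: "monochrome r \<sigma>" "monochrome r \<tau>" using T \<sigma> \<tau> by (auto simp: table_def)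
  have "monochrome r (\<sigma>[k := \<tau> ! k])" "monochrome r (\<tau>[k := \<sigma> ! k])"
    using rows k c unfolding monochrome_def by (auto simp: nth_list_update)
  then have "table r U'" by (simp add: U'_def table_def)
  moreover have mar: "margin j {#\<sigma>, \<tau>#} = margin j U'" if "j < r" for j
    using rows k that by (auto simp: U'_def margin_def monochrome_def nth_list_update)
  moreover have "table r Z" "table r {#\<sigma>, \<tau>#}"
    using T unfolding TZ table_plus by blast+
  ultimately have "step r 2 T (Z + U')"
    unfolding TZ by (intro stepI) (auto simp: U'_def)
  moreover have "margin j (Z + U') = margin j T" if "j < r" for j
    using mar[OF that] unfolding TZ margin_plus by simp
  ultimately show ?thesis unfolding U'_def by (intro exI[of _ "Z + U'"]) (auto simp: U'_def)
qed

text \<open>The entries of \<open>\<rho>\<close> are brought together one position at a time. An entry that is still missing occurs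
in another row, which has the grade of \<open>\<rho>\<close> because of this very entry, so that swapping it in
leaves both rows monochrome.\<close>

lemma connected_to_table_containing_row:
  assumes T: "table r T" and \<rho>: "monochrome r \<rho>" and mem: "\<And>j. j < r \<Longrightarrow> \<rho> ! j \<in># margin j T"
    and r: "0 < r"
  shows "\<exists>T'. connected_by r 2 T T' \<and> (\<forall>j<r. margin j T' = margin j T) \<and> \<rho> \<in># T'"
proof -
  have "\<exists>T' \<sigma>. connected_by r 2 T T' \<and> (\<forall>j<r. margin j T' = margin j T) \<and> \<sigma> \<in># T' \<and>
      \<sigma> ! 0 = \<rho> ! 0 \<and> (\<forall>i<k. \<sigma> ! i = \<rho> ! i)" if "k \<le> r" for k
    using that
  proof (induction k)
    case 0
    obtain \<sigma> where "\<sigma> \<in># T" "\<sigma> ! 0 = \<rho> ! 0" using mem[OF r] by (auto simp: margin_def)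
    then show ?case by blast
  next
    case (Suc k)
    then have k: "k < r" by simp
    obtain T' \<sigma> where *: "connected_by r 2 T T'" "\<forall>j<r. margin j T' = margin j T" "\<sigma> \<in># T'"
      "\<sigma> ! 0 = \<rho> ! 0" "\<forall>i<k. \<sigma> ! i = \<rho> ! i" using Suc by auto
    have T': "table r T'" using connected_by_table[OF *(1) T] .
    show ?case
    proof (cases "\<sigma> ! k = \<rho> ! k")
      case True
      then have "\<forall>i<Suc k. \<sigma> ! i = \<rho> ! i" using *(5) by (simp add: less_Suc_eq)
      with *(1-4) show ?thesis by (intro exI[of _ T'] exI[of _ \<sigma>] conjI)
    next
      case False
      have "\<rho> ! k \<in># margin k T'" using mem[OF k] *(2) k by simp
      then obtain \<tau> where \<tau>: "\<tau> \<in># T'" "\<tau> ! k = \<rho> ! k" by (auto simp: margin_def)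
      have rs: "monochrome r \<sigma>" using T' *(3) by (simp add: table_def)
      have "\<phi> (\<sigma> ! k) = \<phi> (\<tau> ! k)"
        using monochromeD(3)[OF rs k] monochromeD(3)[OF \<rho> k] *(4) \<tau>(2) by argo
      with swap_entries[OF T' *(3) \<tau>(1) _ k] \<tau>(2) False obtain T'' where
        T'': "step r 2 T' T''" "\<forall>j<r. margin j T'' = margin j T'" "\<sigma>[k := \<rho> ! k] \<in># T''" by auto
      have len: "length \<sigma> = r" by (rule monochromeD(1)[OF rs])
      have "\<sigma>[k := \<rho> ! k] ! 0 = \<rho> ! 0" using *(4) k len by (cases "k = 0") auto
      moreover have "\<forall>i<Suc k. \<sigma>[k := \<rho> ! k] ! i = \<rho> ! i"
        using *(5) k len by (auto simp: less_Suc_eq)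
      moreover have "connected_by r 2 T T''" using *(1) T''(1) by simp
      moreover have "\<forall>j<r. margin j T'' = margin j T" using T''(2) *(2) by simp
      ultimately show ?thesis using T''(3)
        by (intro exI[of _ T''] exI[of _ "\<sigma>[k := \<rho> ! k]"] conjI)
    qed
  qed
  from this[of r] obtain T' \<sigma> where *: "connected_by r 2 T T'" "\<forall>j<r. margin j T' = margin j T"
    "\<sigma> \<in># T'" "\<forall>i<r. \<sigma> ! i = \<rho> ! i" by auto
  have "monochrome r \<sigma>" using connected_by_table[OF *(1) T] *(3) by (simp add: table_def)
  then have len: "length \<sigma> = r" "length \<rho> = r" using \<rho> monochromeD(1) by auto
  have "\<sigma> = \<rho>"
    by (rule nth_equalityI) (simp_all only: len *(4)[rule_format])
  then have mem': "\<rho> \<in># T'" using *(3) by (simp only:)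
  show ?thesis
    by (rule exI[of _ T'], intro conjI) (fact *(1) *(2) mem')+
qed

text \<open>The swaps create a row of \<open>T'\<close> inside \<open>T\<close>; after splitting it off, the margins still agree.\<close>

lemma connected_by_swaps:
  assumes "table r T" "table r T'" "0 < r" "\<And>j. j < r \<Longrightarrow> margin j T = margin j T'"
  shows "connected_by r 2 T T'"
  using assms
proof (induction T' arbitrary: T)
  case empty
  then have "size (margin 0 T) = 0" by (metis margin_empty size_empty)
  then show ?case by simp
next
  case (add \<rho> S)
  have \<rho>: "monochrome r \<rho>" and S: "table r S" using add.prems(2) by (auto simp: table_def)
  have "\<rho> ! j \<in># margin j T" if "j < r" for j
    using add.prems(4)[OF that] by (simp add: margin_def)
  from connected_to_table_containing_row[OF add.prems(1) \<rho> this add.prems(3)] obtain T1 where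
    T1: "connected_by r 2 T T1" "\<forall>j<r. margin j T1 = margin j T" "\<rho> \<in># T1" by blast
  obtain Y where Y: "T1 = {#\<rho>#} + Y" using T1(3) by (metis insert_DiffM add_mset_add_single add.commute)
  have "table r Y" using connected_by_table[OF T1(1) add.prems(1)] unfolding Y table_plus by blast
  moreover have "margin j Y = margin j S" if "j < r" for j
    using T1(2) add.prems(4)[OF that] that Y by (auto simp: margin_def)
  ultimately have "connected_by r 2 Y S" using add.IH S add.prems(3) by blast
  then have "connected_by r 2 ({#\<rho>#} + Y) ({#\<rho>#} + S)"
    by (rule connected_by_add) (use \<rho> in \<open>simp add: table_def\<close>)
  then show ?case using T1(1) Y by simp
qed

lemma table_with_margins:
  assumes "\<And>j. j < r \<Longrightarrow> set_mset (V j) \<subseteq> X" "\<And>j. j < r \<Longrightarrow> image_mset \<phi> (V j) = C"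
  shows "\<exists>T. table r T \<and> (\<forall>j<r. margin j T = V j)"
  using assms
proof (induction C arbitrary: V)
  case empty
  then show ?case by (intro exI[of _ "{#}"]) auto
next
  case (add c C)
  have "\<forall>j. \<exists>x. j < r \<longrightarrow> x \<in># V j \<and> \<phi> x = c"
  proof (intro allI)
    fix j
    show "\<exists>x. j < r \<longrightarrow> x \<in># V j \<and> \<phi> x = c"
    proof (cases "j < r")
      case True
      then have "c \<in># image_mset \<phi> (V j)" using add.prems(2) by simp
      then show ?thesis by auto
    qed auto
  qed
  then obtain x where x: "\<And>j. j < r \<Longrightarrow> x j \<in># V j" "\<And>j. j < r \<Longrightarrow> \<phi> (x j) = c" by metis
  have "\<exists>T. table r T \<and> (\<forall>j<r. margin j T = V j - {#x j#})"
  proof (rule add.IH)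
    fix j assume j: "j < r"
    show "set_mset (V j - {#x j#}) \<subseteq> X" using add.prems(1)[OF j] by (meson in_diffD subset_iff)
    show "image_mset \<phi> (V j - {#x j#}) = C"
      using add.prems(2)[OF j] x[OF j] by (simp add: image_mset_Diff)
  qed
  then obtain T where T: "table r T" "\<forall>j<r. margin j T = V j - {#x j#}" by blast
  have "monochrome r (map x [0..<r])"
    unfolding monochrome_def using x add.prems(1) by (intro conjI exI[of _ c]) auto
  then have "table r (add_mset (map x [0..<r]) T)" using T(1) by (simp add: table_def)
  moreover have "margin j (add_mset (map x [0..<r]) T) = V j" if "j < r" for j
    using T(2) that x(1)[OF that] by (simp add: margin_def)
  ultimately show ?case by blast
qed

text \<open>The given table does not have to display \<open>U j\<close> in rows of its own, but by \<open>connected_by_swaps\<close> it can be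
rearranged into a table for \<open>U\<close> next to a table for the rest of the margins. Then a single step
exchanges the former.\<close>

lemma replace_submargins:
  assumes T: "table r T" and r: "0 < r"
    and U: "\<And>j. j < r \<Longrightarrow> U j \<subseteq># margin j T" "\<And>j. j < r \<Longrightarrow> image_mset \<phi> (U j) = E"
    and U': "\<And>j. j < r \<Longrightarrow> set_mset (U' j) \<subseteq> X" "\<And>j. j < r \<Longrightarrow> image_mset \<phi> (U' j) = E'"
    and eq: "\<And>j. j < r \<Longrightarrow> equiv_items (U j) (U' j)"
    and d: "size E \<le> d" "size E' \<le> d" "2 \<le> d"
  shows "\<exists>T'. connected_by r d T T' \<and> (\<forall>j<r. margin j T' = margin j T - U j + U' j)"
proof -
  have UX: "set_mset (U j) \<subseteq> X" if "j < r" for j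
    using U(1)[OF that] table_margin(1)[OF T that] by (blast dest: mset_subset_eqD)
  obtain Y where Y: "table r Y" "\<forall>j<r. margin j Y = U j" using table_with_margins[of r U E] UX U(2) by blast
  obtain Y' where Y': "table r Y'" "\<forall>j<r. margin j Y' = U' j" using table_with_margins[of r U' E'] U' by blast
  have "\<exists>Z. table r Z \<and> (\<forall>j<r. margin j Z = margin j T - U j)"
  proof (rule table_with_margins)
    fix j assume j: "j < r"
    show "set_mset (margin j T - U j) \<subseteq> X" using table_margin(1)[OF T j] by (meson in_diffD subset_iff)
    show "image_mset \<phi> (margin j T - U j) = image_mset \<phi> (margin 0 T) - E"
      using table_margin(2)[OF T j] U(1)[OF j] U(2)[OF j] by (simp add: image_mset_Diff)
  qed
  then obtain Z where Z: "table r Z" "\<forall>j<r. margin j Z = margin j T - U j" by blast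
  have "connected_by r 2 T (Z + Y)"
    using T Z Y r U(1) by (intro connected_by_swaps) (auto simp: subset_mset.diff_add)
  then have "connected_by r d T (Z + Y)" using d(3) connected_by_mono by blast
  moreover have "step r d (Z + Y) (Z + Y')"
  proof -
    have "size Y = size E" using Y(2) U(2)[OF r] r by (metis size_image_mset size_margin)
    moreover have "size Y' = size E'" using Y'(2) U'(2)[OF r] r by (metis size_image_mset size_margin)
    ultimately show ?thesis using Z Y Y' d eq by (intro stepI) auto
  qed
  ultimately have "connected_by r d T (Z + Y')" by simp
  then show ?thesis using Z Y' by (intro exI[of _ "Z + Y'"]) auto
qed

section \<open>Changing all margins at once\<close>

text \<open>The exchanged rows are at most \<open>D\<close> of each grade, and at most \<open>D\<close> further ones after the exchange; swaps
need the degree 2.\<close>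

definition move_bound :: "nat \<Rightarrow> nat" where
  "move_bound D = D * card (\<phi> ` X) + D + 2"

text \<open>The multisets \<open>G\<close> and \<open>G'\<close> encode the signed change \<open>G - G'\<close> of the grades, which is the same for all
margins. The \<open>p j\<close> themselves may have different grades, so they cannot be exchanged as they
are.\<close>

lemma simultaneous_move:
  assumes T: "table r T" and r: "0 < r"
    and p: "\<And>j. j < r \<Longrightarrow> p j \<subseteq># margin j T" "\<And>j. j < r \<Longrightarrow> size (p j) \<le> D"
    and q: "\<And>j. j < r \<Longrightarrow> set_mset (q j) \<subseteq> X" "\<And>j. j < r \<Longrightarrow> size (q j) \<le> D"
    and eq: "\<And>j. j < r \<Longrightarrow> equiv_items (p j) (q j)"
    and col: "\<And>j. j < r \<Longrightarrow> image_mset \<phi> (p j) + G = image_mset \<phi> (q j) + G'"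
  shows "\<exists>T'. connected_by r (move_bound D) T T' \<and> (\<forall>j<r. margin j T' = margin j T - p j + q j)"
proof -
  define C where "C = image_mset \<phi> (margin 0 T)"
  have C: "image_mset \<phi> (margin j T) = C" if "j < r" for j
    using table_margin(2)[OF T that] by (simp add: C_def)
  \<comment> \<open>\<open>E\<close> contains the grades of every \<open>p j\<close> and is contained in the grades of every margin, and its
    size is bounded independently of the table and of \<open>r\<close>.\<close>
  define E where "E = C \<inter># (\<Sum>c\<in>\<phi> ` X. replicate_mset D c)"
  have "finite (\<phi> ` X)" using finite_X by simp
  have sizeE: "size E \<le> D * card (\<phi> ` X)"
  proof -
    have "size E \<le> size (\<Sum>c\<in>\<phi> ` X. replicate_mset D c)"
      unfolding E_def by (intro size_mset_mono) simp
    also have "\<dots> = D * card (\<phi> ` X)"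
      by simp
    finally show ?thesis .
  qed
  have pE: "image_mset \<phi> (p j) \<subseteq># E" if j: "j < r" for j
  proof -
    have "image_mset \<phi> (p j) \<subseteq># C" using p(1)[OF j] C[OF j] image_mset_subseteq_mono by metis
    moreover have "image_mset \<phi> (p j) \<subseteq># (\<Sum>c\<in>\<phi> ` X. replicate_mset D c)"
    proof (rule mset_subset_eqI)
      fix c
      have sub: "set_mset (p j) \<subseteq> X"
        using p(1)[OF j] table_margin(1)[OF T j] by (blast dest: mset_subset_eqD)
      show "count (image_mset \<phi> (p j)) c \<le> count (\<Sum>c\<in>\<phi> ` X. replicate_mset D c) c"
      proof (cases "c \<in> \<phi> ` X")
        case True
        have "count (image_mset \<phi> (p j)) c \<le> size (image_mset \<phi> (p j))" by (rule count_le_size)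
        also have "\<dots> \<le> D" using p(2)[OF j] by simp
        finally show ?thesis using True \<open>finite (\<phi> ` X)\<close> by (simp add: count_sum sum.delta)
      next
        case False
        then have "c \<notin># image_mset \<phi> (p j)" using sub by auto
        then show ?thesis by (metis count_eq_zero_iff zero_le)
      qed
    qed
    ultimately show ?thesis unfolding E_def by simp
  qed
  have "\<exists>U. p j \<subseteq># U \<and> U \<subseteq># margin j T \<and> image_mset \<phi> U = E" if j: "j < r" for j
    by (rule submultiset_with_prescribed_image[OF p(1)[OF j] pE[OF j]]) (simp add: C[OF j] E_def)
  then obtain U where U: "\<And>j. j < r \<Longrightarrow> p j \<subseteq># U j" "\<And>j. j < r \<Longrightarrow> U j \<subseteq># margin j T"
    "\<And>j. j < r \<Longrightarrow> image_mset \<phi> (U j) = E" by metis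
  define U' where "U' j = U j - p j + q j" for j
  have colU': "image_mset \<phi> (U' j) = E + G - G'" if j: "j < r" for j
  proof -
    have "image_mset \<phi> (U' j) + G' = E - image_mset \<phi> (p j) + (image_mset \<phi> (q j) + G')"
      using U(3)[OF j] unfolding U'_def image_mset_union image_mset_Diff[OF U(1)[OF j]]
      by (simp add: add.assoc)
    also have "\<dots> = E - image_mset \<phi> (p j) + image_mset \<phi> (p j) + G"
      using col[OF j] by (simp add: add.assoc)
    also have "\<dots> = E + G" using pE[OF j] by (simp add: subset_mset.diff_add)
    finally show ?thesis by (metis add_diff_cancel_right')
  qed
  have "\<exists>T'. connected_by r (move_bound D) T T' \<and> (\<forall>j<r. margin j T' = margin j T - U j + U' j)"
  proof (rule replace_submargins[OF T r U(2,3)])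
    fix j assume j: "j < r"
    show "set_mset (U' j) \<subseteq> X"
    proof -
      have "set_mset (U j - p j) \<subseteq> set_mset (margin j T)"
        using U(2)[OF j] by (auto dest: mset_subset_eqD in_diffD)
      then show ?thesis using table_margin(1)[OF T j] q(1)[OF j] by (auto simp: U'_def)
    qed
    show "image_mset \<phi> (U' j) = E + G - G'" by (rule colU'[OF j])
    obtain R where "U j = p j + R" using U(1)[OF j] by (metis subset_mset.le_iff_add)
    then show "equiv_items (U j) (U' j)" using eq[OF j] by (simp add: U'_def equiv_items_def)
  next
    show "size E \<le> move_bound D" using sizeE by (simp add: move_bound_def)
    have "size (E + G - G') = size (U' 0)" using colU'[OF r] by (metis size_image_mset)
    also have "\<dots> = size (U 0 - p 0) + size (q 0)" by (simp only: U'_def size_union)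
    also have "\<dots> \<le> size (U 0) + size (q 0)" by (simp add: size_Diff_submset U(1)[OF r])
    also have "size (U 0) = size E" using U(3)[OF r] by (metis size_image_mset)
    finally show "size (E + G - G') \<le> move_bound D"
      using sizeE q(2)[OF r] by (simp add: move_bound_def)
  qed (simp_all add: move_bound_def)
  moreover have "margin j T - U j + U' j = margin j T - p j + q j" if j: "j < r" for j
  proof -
    obtain R where R: "U j = p j + R" using U(1)[OF j] by (metis subset_mset.le_iff_add)
    obtain S where S: "margin j T = U j + S" using U(2)[OF j] by (metis subset_mset.le_iff_add)
    show ?thesis unfolding U'_def S by (simp add: R)
  qed
  ultimately show ?thesis by metis
qed

text \<open>Pairs of multisets with the same sum of columns and the same grades form a monoid. Dickson's lemma
bounds the size of its irreducible elements, and replacing them one after another in all margins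
does not affect the grades.\<close>

lemma connected_by_equal_grades:
  "\<exists>d. \<forall>r>0. \<forall>T T'. table r T \<longrightarrow> table r T' \<longrightarrow>
     (\<forall>j<r. equiv_items (margin j T) (margin j T')) \<longrightarrow>
     image_mset \<phi> (margin 0 T) = image_mset \<phi> (margin 0 T') \<longrightarrow> connected_by r d T T'"
proof -
  define A where "A = {(v, w). set_mset v \<subseteq> X \<and> set_mset w \<subseteq> X \<and> equiv_items v w \<and>
    image_mset \<phi> v = image_mset \<phi> w \<and> (v \<noteq> {#} \<or> w \<noteq> {#})}"
  obtain D where D: "\<forall>(v, w)\<in>A. \<exists>(p, q)\<in>A. p \<subseteq># v \<and> q \<subseteq># w \<and> size p \<le> D \<and> size q \<le> D"
    using multiset_pairs_bounded_below[OF finite_X finite_X, of A] unfolding A_def by blast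
  \<comment> \<open>\<open>Z j\<close> is the part of the \<open>j\<close>-th margin that agrees with the target already. It grows with each
    replacement, so the induction is on a bound for the remaining parts \<open>V j\<close> and \<open>W j\<close>.\<close>
  have main: "\<exists>T'. connected_by r (move_bound D) T T' \<and> (\<forall>j<r. margin j T' = Z j + W j)"
    if "0 < r" "table r T" "\<And>j. j < r \<Longrightarrow> margin j T = Z j + V j"
      "\<And>j. j < r \<Longrightarrow> set_mset (W j) \<subseteq> X" "\<And>j. j < r \<Longrightarrow> equiv_items (V j) (W j)"
      "\<And>j. j < r \<Longrightarrow> image_mset \<phi> (V j) = image_mset \<phi> (W j)"
      "\<And>j. j < r \<Longrightarrow> size (V j) + size (W j) \<le> N" for r T Z V W N
    using that
  proof (induction N arbitrary: T Z V W)
    case 0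
    then have "\<forall>j<r. margin j T = Z j + W j" by auto
    then show ?case by blast
  next
    case (Suc N)
    have VX: "set_mset (V j) \<subseteq> X" if j: "j < r" for j
      using table_margin(1)[OF Suc.prems(2) j] Suc.prems(3)[OF j] by auto
    have "\<forall>j<r. \<exists>p q. p \<subseteq># V j \<and> q \<subseteq># W j \<and> equiv_items p q \<and> image_mset \<phi> p = image_mset \<phi> q \<and>
        size p \<le> D \<and> size q \<le> D \<and> size (V j - p) + size (W j - q) \<le> N"
    proof (intro allI impI)
      fix j assume j: "j < r"
      show "\<exists>p q. p \<subseteq># V j \<and> q \<subseteq># W j \<and> equiv_items p q \<and> image_mset \<phi> p = image_mset \<phi> q \<and>
        size p \<le> D \<and> size q \<le> D \<and> size (V j - p) + size (W j - q) \<le> N"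
      proof (cases "V j = {#} \<and> W j = {#}")
        case True
        then show ?thesis by (intro exI[of _ "{#}"]) auto
      next
        case False
        then have "(V j, W j) \<in> A" using VX Suc.prems(4-6) j by (auto simp: A_def)
        then obtain p q where pq: "(p, q) \<in> A" "p \<subseteq># V j" "q \<subseteq># W j" "size p \<le> D" "size q \<le> D"
          using D by blast
        have "size p + size q > 0" using pq(1) by (auto simp: A_def nonempty_has_size)
        moreover have "size p \<le> size (V j)" "size q \<le> size (W j)" using pq by (auto intro: size_mset_mono)
        ultimately have "size (V j - p) + size (W j - q) \<le> N"
          using Suc.prems(7)[OF j] pq(2,3) by (simp add: size_Diff_submset) linarith
        then show ?thesis using pq unfolding A_def by blast
      qed
    qed
    from choose_pairs[OF this] obtain p q where
      "\<forall>j<r. p j \<subseteq># V j \<and> q j \<subseteq># W j \<and> equiv_items (p j) (q j) \<and>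
        image_mset \<phi> (p j) = image_mset \<phi> (q j) \<and> size (p j) \<le> D \<and> size (q j) \<le> D \<and>
        size (V j - p j) + size (W j - q j) \<le> N" by blast
    then have pq: "\<And>j. j < r \<Longrightarrow> p j \<subseteq># V j" "\<And>j. j < r \<Longrightarrow> q j \<subseteq># W j"
      "\<And>j. j < r \<Longrightarrow> equiv_items (p j) (q j)"
      "\<And>j. j < r \<Longrightarrow> image_mset \<phi> (p j) = image_mset \<phi> (q j)"
      "\<And>j. j < r \<Longrightarrow> size (p j) \<le> D" "\<And>j. j < r \<Longrightarrow> size (q j) \<le> D"
      "\<And>j. j < r \<Longrightarrow> size (V j - p j) + size (W j - q j) \<le> N" by auto
    have qX: "set_mset (q j) \<subseteq> X" if "j < r" for j
      using set_mset_mono[OF pq(2)[OF that]] Suc.prems(4)[OF that] by blast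
    have pT: "p j \<subseteq># margin j T" if "j < r" for j
      unfolding Suc.prems(3)[OF that]
      using pq(1)[OF that] by (rule subset_mset.order_trans) simp
    obtain T1 where T1: "connected_by r (move_bound D) T T1"
      "\<forall>j<r. margin j T1 = margin j T - p j + q j"
      using simultaneous_move[OF Suc.prems(2,1) pT pq(5) qX pq(6,3), of "{#}" "{#}"] pq(4) by auto
    have "\<exists>T'. connected_by r (move_bound D) T1 T' \<and>
        (\<forall>j<r. margin j T' = (Z j + q j) + (W j - q j))"
    proof (rule Suc.IH)
      show "0 < r" by (rule Suc.prems(1))
      show "table r T1" using connected_by_table[OF T1(1) Suc.prems(2)] .
      fix j assume j: "j < r"
      obtain V' where V': "V j = p j + V'" using pq(1)[OF j] by (metis subset_mset.le_iff_add)
      obtain W' where W': "W j = q j + W'" using pq(2)[OF j] by (metis subset_mset.le_iff_add)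
      show "margin j T1 = (Z j + q j) + (V j - p j)"
        using T1(2) j Suc.prems(3)[OF j] V' by (simp add: ac_simps)
      show "set_mset (W j - q j) \<subseteq> X" using Suc.prems(4)[OF j] by (meson in_diffD subset_iff)
      show "equiv_items (V j - p j) (W j - q j)"
        using Suc.prems(5)[OF j] pq(3)[OF j] V' W' by (auto simp: equiv_items_def)
      show "image_mset \<phi> (V j - p j) = image_mset \<phi> (W j - q j)"
        using Suc.prems(6)[OF j] pq(4)[OF j] V' W' by auto
      show "size (V j - p j) + size (W j - q j) \<le> N" by (rule pq(7)[OF j])
    qed
    then obtain T' where T': "connected_by r (move_bound D) T1 T'"
      "\<forall>j<r. margin j T' = (Z j + q j) + (W j - q j)" by blast
    have "\<forall>j<r. margin j T' = Z j + W j" using T'(2) pq(2) by (simp add: add.assoc)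
    moreover have "connected_by r (move_bound D) T T'" using T1(1) T'(1) by simp
    ultimately show ?case by blast
  qed
  have "connected_by r (move_bound D) T T'"
    if r: "0 < r" and T: "table r T" and T': "table r T'"
      and eq: "\<forall>j<r. equiv_items (margin j T) (margin j T')"
      and col: "image_mset \<phi> (margin 0 T) = image_mset \<phi> (margin 0 T')" for r T T'
  proof -
    have "\<exists>S. connected_by r (move_bound D) T S \<and> (\<forall>j<r. margin j S = {#} + margin j T')"
    proof (rule main[OF r T, where V = "\<lambda>j. margin j T" and N = "size T + size T'"])
      fix j assume j: "j < r"
      show "image_mset \<phi> (margin j T) = image_mset \<phi> (margin j T')"
        using table_margin(2)[OF T j] table_margin(2)[OF T' j] col by simp
    qed (use eq table_margin(1)[OF T'] in auto)
    then obtain S where S: "connected_by r (move_bound D) T S" "\<forall>j<r. margin j S = margin j T'" by auto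
    have "connected_by r 2 S T'"
      using connected_by_swaps[OF connected_by_table[OF S(1) T] T' r] S(2) by blast
    then have "connected_by r (move_bound D) S T'"
      by (rule connected_by_mono) (simp add: move_bound_def)
    then show ?thesis using S(1) by simp
  qed
  then show ?thesis by blast
qed

end

section \<open>Steps between different grades\<close>

text \<open>The sign-compatible order on the integers, applied coordinatewise in the definition of Graver bases.\<close>

definition conformal :: "int \<Rightarrow> int \<Rightarrow> bool" where
  "conformal \<delta> \<Delta> \<longleftrightarrow> 0 \<le> \<delta> \<and> \<delta> \<le> \<Delta> \<or> \<Delta> \<le> \<delta> \<and> \<delta> \<le> 0"

text \<open>Normality in terms of multisets. For a matrix with normal semigroup, the set \<open>K\<close> consists of the values that the functionals defining the
cone of \<open>\<B>\<^sup>\<phi>\<close> take at the columns. \<open>K_respects\<close> says that they depend only on the point of the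
semigroup which a multiset represents. The difference of the points represented by \<open>Q\<close> and \<open>P\<close> is
an arbitrary lattice point, so \<open>K_saturated\<close> says that lattice points of the cone belong to the
semigroup.\<close>

locale normal_graded_items = graded_items X I \<beta> \<phi>
  for X :: "'a set" and I :: "'i set" and \<beta> :: "'i \<Rightarrow> 'a \<Rightarrow> int" and \<phi> :: "'a \<Rightarrow> 'c" +
  fixes K :: "('a \<Rightarrow> int) set"
  assumes finite_K: "finite K"
    and K_nonneg: "\<kappa> \<in> K \<Longrightarrow> x \<in> X \<Longrightarrow> 0 \<le> \<kappa> x"
    and K_respects: "\<kappa> \<in> K \<Longrightarrow> set_mset P \<subseteq> X \<Longrightarrow> set_mset Q \<subseteq> X \<Longrightarrow> equiv_items P Q \<Longrightarrow>
      image_mset \<phi> P = image_mset \<phi> Q \<Longrightarrow> weight \<kappa> P = weight \<kappa> Q"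
    and K_saturated: "set_mset P \<subseteq> X \<Longrightarrow> set_mset Q \<subseteq> X \<Longrightarrow>
      (\<And>\<kappa>. \<kappa> \<in> K \<Longrightarrow> weight \<kappa> P \<le> weight \<kappa> Q) \<Longrightarrow>
      \<exists>R. set_mset R \<subseteq> X \<and> equiv_items Q (P + R) \<and> image_mset \<phi> Q = image_mset \<phi> (P + R)"
begin

text \<open>The multiplicities of the grades are included so that the functionals tell different multisets of
grades apart.\<close>

definition functionals :: "('a \<Rightarrow> int) set" where
  "functionals = K \<union> (\<lambda>c x. of_bool (\<phi> x = c)) ` \<phi> ` X"

lemma weight_indicator: "weight (\<lambda>x. of_bool (\<phi> x = c)) V = int (count (image_mset \<phi> V) c)"
  by (induction V) auto

lemma finite_functionals: "finite functionals"
  using finite_K finite_X by (simp add: functionals_def)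

lemma functionals_nonneg: "\<kappa> \<in> functionals \<Longrightarrow> set_mset V \<subseteq> X \<Longrightarrow> 0 \<le> weight \<kappa> V"
proof (induction V)
  case (add x V)
  then have "0 \<le> \<kappa> x" using K_nonneg by (auto simp: functionals_def)
  then show ?case using add by simp
qed simp

lemma functionals_respect:
  assumes "\<kappa> \<in> functionals" "set_mset P \<subseteq> X" "set_mset Q \<subseteq> X" "equiv_items P Q"
    "image_mset \<phi> P = image_mset \<phi> Q"
  shows "weight \<kappa> P = weight \<kappa> Q"
proof (cases "\<kappa> \<in> K")
  case True
  then show ?thesis by (rule K_respects[OF _ assms(2-5)])
next
  case False
  then obtain c where "\<kappa> = (\<lambda>x. of_bool (\<phi> x = c))" using assms(1) by (auto simp: functionals_def)
  then show ?thesis by (simp only: weight_indicator assms(5))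
qed

lemma functionals_separate:
  assumes "set_mset v \<subseteq> X" "set_mset w \<subseteq> X" "image_mset \<phi> v \<noteq> image_mset \<phi> w"
  shows "\<exists>\<kappa>\<in>functionals. weight \<kappa> v \<noteq> weight \<kappa> w"
proof -
  obtain c where c: "count (image_mset \<phi> v) c \<noteq> count (image_mset \<phi> w) c"
    using assms(3) by (meson multiset_eqI)
  have "c \<in> \<phi> ` X"
  proof (rule ccontr)
    assume "c \<notin> \<phi> ` X"
    then have "c \<notin># image_mset \<phi> v" "c \<notin># image_mset \<phi> w" using assms(1,2) by auto
    then show False using c by (metis count_eq_zero_iff)
  qed
  then have "(\<lambda>x. of_bool (\<phi> x = c)) \<in> functionals" by (auto simp: functionals_def)
  moreover have "weight (\<lambda>x. of_bool (\<phi> x = c)) v \<noteq> weight (\<lambda>x. of_bool (\<phi> x = c)) w"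
    using c by (simp add: weight_indicator)
  ultimately show ?thesis by blast
qed

definition grade_changes :: "('a multiset \<times> 'a multiset) set" where
  "grade_changes = {(v, w). set_mset v \<subseteq> X \<and> set_mset w \<subseteq> X \<and> equiv_items v w \<and>
     image_mset \<phi> v \<noteq> image_mset \<phi> w}"

text \<open>Dickson's lemma is applied to the positive and negative parts of the values of all functionals on
the differences; \<open>(v, w)\<close> is conformal to \<open>(V, W)\<close> if none of these parts is larger.\<close>

lemma finite_conformal_steps:
  "\<exists>F\<subseteq>grade_changes. finite F \<and> (\<forall>(V, W)\<in>grade_changes. \<exists>(v, w)\<in>F. \<forall>\<kappa>\<in>functionals.
     conformal (weight \<kappa> w - weight \<kappa> v) (weight \<kappa> W - weight \<kappa> V))"
proof -
  define Fs where "Fs = (\<lambda>\<kappa> (v, w). nat (weight \<kappa> w - weight \<kappa> v)) ` functionals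
    \<union> (\<lambda>\<kappa> (v, w). nat (weight \<kappa> v - weight \<kappa> w)) ` functionals"
  have "finite Fs" using finite_functionals by (simp add: Fs_def)
  from dickson_finite_lower_set[OF this, of grade_changes] obtain F where
    F: "F \<subseteq> grade_changes" "finite F" "\<forall>a\<in>grade_changes. \<exists>b\<in>F. \<forall>f\<in>Fs. f b \<le> f a" by blast
  have "\<exists>(v, w)\<in>F. \<forall>\<kappa>\<in>functionals. conformal (weight \<kappa> w - weight \<kappa> v) (weight \<kappa> W - weight \<kappa> V)"
    if VW: "(V, W) \<in> grade_changes" for V W
  proof -
    obtain v w where vw: "(v, w) \<in> F" "\<forall>f\<in>Fs. f (v, w) \<le> f (V, W)"
      using F(3) VW by (metis (no_types, lifting) surj_pair)
    have "conformal (weight \<kappa> w - weight \<kappa> v) (weight \<kappa> W - weight \<kappa> V)" if "\<kappa> \<in> functionals" for \<kappa>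
    proof -
      have "(\<lambda>(v, w). nat (weight \<kappa> w - weight \<kappa> v)) \<in> Fs"
        "(\<lambda>(v, w). nat (weight \<kappa> v - weight \<kappa> w)) \<in> Fs" using that by (auto simp: Fs_def)
      then have "nat (weight \<kappa> w - weight \<kappa> v) \<le> nat (weight \<kappa> W - weight \<kappa> V)"
        "nat (weight \<kappa> v - weight \<kappa> w) \<le> nat (weight \<kappa> V - weight \<kappa> W)"
        using vw(2) by fastforce+
      then show ?thesis unfolding conformal_def by linarith
    qed
    then show ?thesis using vw(1) by blast
  qed
  then show ?thesis using F(1,2) by blast
qed

text \<open>A margin \<open>V\<close> can follow the change of grades from \<open>v\<close> to \<open>w\<close> by replacing at most \<open>D\<close> elements, provided
that it can follow this change at all, by turning into some \<open>R\<close>. The grade condition, written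
without subtraction, says that \<open>R\<close> differs from \<open>V\<close> in its grades as \<open>w\<close> does from \<open>v\<close>.\<close>

definition lift_bound :: "'a multiset \<Rightarrow> 'a multiset \<Rightarrow> nat \<Rightarrow> bool" where
  "lift_bound v w D \<longleftrightarrow>
    (\<forall>V R. set_mset V \<subseteq> X \<and> set_mset R \<subseteq> X \<and> equiv_items V R \<and>
      image_mset \<phi> V + image_mset \<phi> w = image_mset \<phi> R + image_mset \<phi> v \<longrightarrow>
      (\<exists>p q. p \<subseteq># V \<and> q \<subseteq># R \<and> equiv_items p q \<and> size p \<le> D \<and> size q \<le> D \<and>
        image_mset \<phi> p + image_mset \<phi> w = image_mset \<phi> q + image_mset \<phi> v))"

lemma lift_bound_exists: "\<exists>D. lift_bound v w D"
proof -
  define A where "A = {(V, R). set_mset V \<subseteq> X \<and> set_mset R \<subseteq> X \<and> equiv_items V R \<and>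
    image_mset \<phi> V + image_mset \<phi> w = image_mset \<phi> R + image_mset \<phi> v}"
  obtain D where D: "\<forall>(V, R)\<in>A. \<exists>(p, q)\<in>A. p \<subseteq># V \<and> q \<subseteq># R \<and> size p \<le> D \<and> size q \<le> D"
    using multiset_pairs_bounded_below[OF finite_X finite_X, of A] unfolding A_def by blast
  have "lift_bound v w D"
    unfolding lift_bound_def
  proof (intro allI impI)
    fix V R
    assume "set_mset V \<subseteq> X \<and> set_mset R \<subseteq> X \<and> equiv_items V R \<and>
      image_mset \<phi> V + image_mset \<phi> w = image_mset \<phi> R + image_mset \<phi> v"
    then have "(V, R) \<in> A" by (simp add: A_def)
    then obtain p q where "(p, q) \<in> A" "p \<subseteq># V" "q \<subseteq># R" "size p \<le> D" "size q \<le> D"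
      using D by blast
    then show "\<exists>p q. p \<subseteq># V \<and> q \<subseteq># R \<and> equiv_items p q \<and> size p \<le> D \<and> size q \<le> D \<and>
        image_mset \<phi> p + image_mset \<phi> w = image_mset \<phi> q + image_mset \<phi> v"
      unfolding A_def by (intro exI[of _ p] exI[of _ q]) auto
  qed
  then show ?thesis by blast
qed

lemma lift_boundD:
  assumes "lift_bound v w D" "set_mset V \<subseteq> X" "set_mset R \<subseteq> X" "equiv_items V R"
    "image_mset \<phi> V + image_mset \<phi> w = image_mset \<phi> R + image_mset \<phi> v"
  obtains p q where "p \<subseteq># V" "q \<subseteq># R" "equiv_items p q" "size p \<le> D" "size q \<le> D"
    "image_mset \<phi> p + image_mset \<phi> w = image_mset \<phi> q + image_mset \<phi> v"
  using assms(1)[unfolded lift_bound_def, rule_format, of V R] assms(2-) by auto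

lemma lift_bound_mono:
  assumes "lift_bound v w D" "D \<le> D'"
  shows "lift_bound v w D'"
  unfolding lift_bound_def
proof (intro allI impI, elim conjE)
  fix V R
  assume "set_mset V \<subseteq> X" "set_mset R \<subseteq> X" "equiv_items V R"
    "image_mset \<phi> V + image_mset \<phi> w = image_mset \<phi> R + image_mset \<phi> v"
  with assms(1) obtain p q where "p \<subseteq># V" "q \<subseteq># R" "equiv_items p q" "size p \<le> D" "size q \<le> D"
    "image_mset \<phi> p + image_mset \<phi> w = image_mset \<phi> q + image_mset \<phi> v"
    by (rule lift_boundD)
  then show "\<exists>p q. p \<subseteq># V \<and> q \<subseteq># R \<and> equiv_items p q \<and> size p \<le> D' \<and> size q \<le> D' \<and>
      image_mset \<phi> p + image_mset \<phi> w = image_mset \<phi> q + image_mset \<phi> v"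
    using assms(2) by (intro exI[of _ p] exI[of _ q]) auto
qed

lemma uniform_lift_bound:
  assumes "finite F"
  shows "\<exists>D. \<forall>(v, w)\<in>F. lift_bound v w D"
proof -
  have "\<forall>z. \<exists>D. lift_bound (fst z) (snd z) D" using lift_bound_exists by blast
  then obtain f where f: "\<forall>z. lift_bound (fst z) (snd z) (f z)" by (rule choice[THEN exE])
  have "lift_bound v w (sum f F)" if "(v, w) \<in> F" for v w
  proof (rule lift_bound_mono)
    show "lift_bound v w (f (v, w))" using f[rule_format, of "(v, w)"] by simp
    show "f (v, w) \<le> sum f F" by (rule member_le_sum[OF that _ assms]) simp
  qed
  then show ?thesis by blast
qed

text \<open>A measure for the distance of two multisets of grades; on multisets with the same sum of columns,
it depends on nothing but the grades.\<close>

definition grade_distance :: "'a multiset \<Rightarrow> 'a multiset \<Rightarrow> nat" where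
  "grade_distance V W = (\<Sum>\<kappa>\<in>functionals. nat \<bar>weight \<kappa> W - weight \<kappa> V\<bar>)"

text \<open>Induction on the distance of the grades. As the differences \<open>margin j T' - margin j T\<close> represent the
same vector for all \<open>j\<close>, a step that is conformal for \<open>j = 0\<close> is conformal for all \<open>j\<close>. Each functional
then lies, after the step, between its values at the two margins, so it is nonnegative, and
saturation provides the new margins.\<close>

lemma connected_by_equiv_margins:
  "\<exists>d. \<forall>r>0. \<forall>T T'. table r T \<longrightarrow> table r T' \<longrightarrow>
     (\<forall>j<r. equiv_items (margin j T) (margin j T')) \<longrightarrow> connected_by r d T T'"
proof -
  obtain F where F: "F \<subseteq> grade_changes" "finite F"
    "\<forall>(V, W)\<in>grade_changes. \<exists>(v, w)\<in>F. \<forall>\<kappa>\<in>functionals.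
       conformal (weight \<kappa> w - weight \<kappa> v) (weight \<kappa> W - weight \<kappa> V)"
    using finite_conformal_steps by (elim exE conjE)
  obtain D where D: "\<And>v w. (v, w) \<in> F \<Longrightarrow> lift_bound v w D"
    using uniform_lift_bound[OF F(2)] by blast
  obtain d0 where "\<forall>r>0. \<forall>T T'. table r T \<longrightarrow> table r T' \<longrightarrow>
     (\<forall>j<r. equiv_items (margin j T) (margin j T')) \<longrightarrow>
     image_mset \<phi> (margin 0 T) = image_mset \<phi> (margin 0 T') \<longrightarrow> connected_by r d0 T T'"
    using connected_by_equal_grades by (rule exE)
  note d0 = this[rule_format]
  define d where "d = max d0 (move_bound D)"
  have "connected_by r d T T'"
    if "0 < r" "table r T" "table r T'" "\<And>j. j < r \<Longrightarrow> equiv_items (margin j T) (margin j T')" for r T T'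
    using that
  proof (induction "grade_distance (margin 0 T) (margin 0 T')" arbitrary: T rule: less_induct)
    case less
    note r = less.prems(1) and T = less.prems(2) and T' = less.prems(3) and eqv = less.prems(4)
    let ?V = "\<lambda>j. margin j T" and ?W = "\<lambda>j. margin j T'"
    show ?case
    proof (cases "image_mset \<phi> (?V 0) = image_mset \<phi> (?W 0)")
      case True
      have "connected_by r d0 T T'" by (rule d0[OF r T T' eqv True])
      then show ?thesis by (rule connected_by_mono) (simp add: d_def)
    next
      case False
      have VX: "set_mset (?V j) \<subseteq> X" and WX: "set_mset (?W j) \<subseteq> X" if "j < r" for j
        using table_margin(1) T T' that by blast+
      obtain v w where vw: "(v, w) \<in> F" and conf0: "\<forall>\<kappa>\<in>functionals. conformal (weight \<kappa> w - weight \<kappa> v) (weight \<kappa> (?W 0) - weight \<kappa> (?V 0))"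
      proof -
        have "(?V 0, ?W 0) \<in> grade_changes"
          using VX[OF r] WX[OF r] eqv[OF r] False by (simp add: grade_changes_def)
        with F(3) show thesis using that by blast
      qed
      have vwX: "set_mset v \<subseteq> X" "set_mset w \<subseteq> X" "equiv_items v w" "image_mset \<phi> v \<noteq> image_mset \<phi> w"
        using F(1) vw by (auto simp: grade_changes_def)
      have shift: "weight \<kappa> (?W j) - weight \<kappa> (?V j) = weight \<kappa> (?W 0) - weight \<kappa> (?V 0)"
        if "\<kappa> \<in> functionals" "j < r" for \<kappa> j
      proof -
        have "weight \<kappa> (?W j + ?V 0) = weight \<kappa> (?V j + ?W 0)"
        proof (rule functionals_respect[OF that(1)])
          show "equiv_items (?W j + ?V 0) (?V j + ?W 0)"
            using eqv[OF that(2)] eqv[OF r] by (simp add: equiv_items_def)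
          show "image_mset \<phi> (?W j + ?V 0) = image_mset \<phi> (?V j + ?W 0)"
            using table_margin(2)[OF T that(2)] table_margin(2)[OF T' that(2)] by (simp add: ac_simps)
        qed (use VX WX that r in auto)
        then show ?thesis by simp
      qed
      have "\<forall>j<r. \<exists>p q. p \<subseteq># ?V j \<and> set_mset q \<subseteq> X \<and> equiv_items p q \<and> size p \<le> D \<and> size q \<le> D \<and>
          image_mset \<phi> p + image_mset \<phi> w = image_mset \<phi> q + image_mset \<phi> v"
      proof (intro allI impI)
        fix j assume j: "j < r"
        \<comment> \<open>If the step increases \<open>\<kappa>\<close>, compare with \<open>margin j T\<close>, otherwise with \<open>margin j T'\<close>.\<close>
        have le: "weight \<kappa> v \<le> weight \<kappa> (?V j + w)" if \<kappa>: "\<kappa> \<in> functionals" for \<kappa>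
        proof -
          have "0 \<le> weight \<kappa> (?V j)" "0 \<le> weight \<kappa> (?W j)"
            using functionals_nonneg[OF \<kappa>] VX[OF j] WX[OF j] by auto
          moreover have "0 \<le> weight \<kappa> w - weight \<kappa> v \<or>
              weight \<kappa> (?W j) - weight \<kappa> (?V j) \<le> weight \<kappa> w - weight \<kappa> v"
            using conf0 \<kappa> unfolding shift[OF \<kappa> j] conformal_def by fastforce
          ultimately show ?thesis by auto
        qed
        obtain R where R: "set_mset R \<subseteq> X" "equiv_items (?V j + w) (v + R)"
          "image_mset \<phi> (?V j + w) = image_mset \<phi> (v + R)"
          using K_saturated[of v "?V j + w"] vwX(1,2) VX[OF j] le by (auto simp: functionals_def)
        have "equiv_items (?V j) R" using R(2) vwX(3) by (simp add: equiv_items_def)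
        then obtain p q where "p \<subseteq># ?V j" "q \<subseteq># R" "equiv_items p q" "size p \<le> D" "size q \<le> D"
          "image_mset \<phi> p + image_mset \<phi> w = image_mset \<phi> q + image_mset \<phi> v"
          by (rule lift_boundD[OF D[OF vw] VX[OF j] R(1)]) (use R(3) in \<open>simp add: ac_simps\<close>)
        moreover have "set_mset q \<subseteq> X" using set_mset_mono[OF \<open>q \<subseteq># R\<close>] R(1) by blast
        ultimately show "\<exists>p q. p \<subseteq># ?V j \<and> set_mset q \<subseteq> X \<and> equiv_items p q \<and> size p \<le> D \<and>
          size q \<le> D \<and> image_mset \<phi> p + image_mset \<phi> w = image_mset \<phi> q + image_mset \<phi> v" by blast
      qed
      from choose_pairs[OF this] obtain p q where
        "\<forall>j<r. p j \<subseteq># ?V j \<and> set_mset (q j) \<subseteq> X \<and> equiv_items (p j) (q j) \<and> size (p j) \<le> D \<and>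
          size (q j) \<le> D \<and> image_mset \<phi> (p j) + image_mset \<phi> w = image_mset \<phi> (q j) + image_mset \<phi> v"
        by blast
      then have pq: "\<And>j. j < r \<Longrightarrow> p j \<subseteq># ?V j" "\<And>j. j < r \<Longrightarrow> set_mset (q j) \<subseteq> X"
        "\<And>j. j < r \<Longrightarrow> equiv_items (p j) (q j)" "\<And>j. j < r \<Longrightarrow> size (p j) \<le> D"
        "\<And>j. j < r \<Longrightarrow> size (q j) \<le> D"
        "\<And>j. j < r \<Longrightarrow> image_mset \<phi> (p j) + image_mset \<phi> w = image_mset \<phi> (q j) + image_mset \<phi> v"
        by auto
      obtain T1 where T1: "connected_by r (move_bound D) T T1"
        "\<And>j. j < r \<Longrightarrow> margin j T1 = ?V j - p j + q j"
        using simultaneous_move[OF T r pq(1,4,2,5,3,6)] by blast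
      have T1t: "table r T1" using connected_by_table[OF T1(1) T] .
      have change: "weight \<kappa> (margin 0 T1) - weight \<kappa> (?V 0) = weight \<kappa> w - weight \<kappa> v"
        if \<kappa>: "\<kappa> \<in> functionals" for \<kappa>
      proof -
        have pX: "set_mset (p 0) \<subseteq> X" using set_mset_mono[OF pq(1)[OF r]] VX[OF r] by blast
        have "weight \<kappa> (p 0 + w) = weight \<kappa> (q 0 + v)"
          by (rule functionals_respect[OF \<kappa>])
            (use pX pq(2,3,6)[OF r] vwX in \<open>auto simp: equiv_items_def\<close>)
        moreover obtain Z where Z: "?V 0 = p 0 + Z" using pq(1)[OF r] by (metis subset_mset.le_iff_add)
        ultimately show ?thesis unfolding T1(2)[OF r] Z by simp
      qed
      have "grade_distance (margin 0 T1) (?W 0) < grade_distance (?V 0) (?W 0)"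
        unfolding grade_distance_def
      proof (rule sum_strict_mono_ex1[OF finite_functionals])
        show "\<forall>\<kappa>\<in>functionals. nat \<bar>weight \<kappa> (?W 0) - weight \<kappa> (margin 0 T1)\<bar>
            \<le> nat \<bar>weight \<kappa> (?W 0) - weight \<kappa> (?V 0)\<bar>"
        proof
          fix \<kappa> assume \<kappa>: "\<kappa> \<in> functionals"
          show "nat \<bar>weight \<kappa> (?W 0) - weight \<kappa> (margin 0 T1)\<bar>
            \<le> nat \<bar>weight \<kappa> (?W 0) - weight \<kappa> (?V 0)\<bar>"
            using conf0[rule_format, OF \<kappa>] change[OF \<kappa>] unfolding conformal_def by linarith
        qed
        obtain \<kappa> where \<kappa>: "\<kappa> \<in> functionals" "weight \<kappa> v \<noteq> weight \<kappa> w"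
          using functionals_separate[OF vwX(1,2,4)] by blast
        then have "nat \<bar>weight \<kappa> (?W 0) - weight \<kappa> (margin 0 T1)\<bar>
            < nat \<bar>weight \<kappa> (?W 0) - weight \<kappa> (?V 0)\<bar>"
          using conf0[rule_format, OF \<kappa>(1)] change[OF \<kappa>(1)] unfolding conformal_def by linarith
        then show "\<exists>\<kappa>\<in>functionals. nat \<bar>weight \<kappa> (?W 0) - weight \<kappa> (margin 0 T1)\<bar>
            < nat \<bar>weight \<kappa> (?W 0) - weight \<kappa> (?V 0)\<bar>" using \<kappa>(1) by blast
      qed
      moreover have "equiv_items (margin j T1) (?W j)" if "j < r" for j
        using connected_by_equiv[OF T1(1) that] eqv[OF that] by (simp add: equiv_items_def)
      ultimately have "connected_by r d T1 T'" using less.hyps r T1t T' by blast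
      moreover have "connected_by r d T T1" using connected_by_mono[OF T1(1)] by (simp add: d_def)
      ultimately show ?thesis by simp
    qed
  qed
  then show ?thesis by blast
qed

end

section \<open>Finitely generated cones are polyhedral\<close>

text \<open>One step of Fourier-Motzkin elimination: \<open>l\<close> exists iff every lower bound \<open>b h' / a h'\<close> from
\<open>a h' < 0\<close>, and the lower bound \<open>0\<close>, are at most every upper bound \<open>b h / a h\<close> from \<open>a h > 0\<close>, and
\<open>b h \<ge> 0\<close> wherever \<open>a h = 0\<close>.\<close>

lemma bounded_multiplier_exists_iff:
  fixes a b :: "'h \<Rightarrow> real"
  assumes "finite H"
  shows "(\<exists>l\<ge>0. \<forall>h\<in>H. l * a h \<le> b h) \<longleftrightarrow>
    (\<forall>h\<in>H. 0 \<le> a h \<longrightarrow> 0 \<le> b h) \<and>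
    (\<forall>h\<in>H. \<forall>h'\<in>H. 0 < a h \<longrightarrow> a h' < 0 \<longrightarrow> 0 \<le> a h * b h' - a h' * b h)"
proof (intro iffI conjI ballI impI)
  fix h assume "\<exists>l\<ge>0. \<forall>h\<in>H. l * a h \<le> b h" "h \<in> H" "0 \<le> a h"
  then show "0 \<le> b h" by (meson mult_nonneg_nonneg order_trans)
next
  fix h h' assume "\<exists>l\<ge>0. \<forall>h\<in>H. l * a h \<le> b h" and h: "h \<in> H" "h' \<in> H" "0 < a h" "a h' < 0"
  then obtain l where l: "l * a h \<le> b h" "l * a h' \<le> b h'" by blast
  have "a h * (l * a h') \<le> a h * b h'" using l(2) h(3) by (intro mult_left_mono) auto
  moreover have "a h' * b h \<le> a h' * (l * a h)" using l(1) h(4) by (intro mult_left_mono_neg) auto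
  ultimately show "0 \<le> a h * b h' - a h' * b h" by (simp add: mult.left_commute mult.commute)
next
  assume "(\<forall>h\<in>H. 0 \<le> a h \<longrightarrow> 0 \<le> b h) \<and>
    (\<forall>h\<in>H. \<forall>h'\<in>H. 0 < a h \<longrightarrow> a h' < 0 \<longrightarrow> 0 \<le> a h * b h' - a h' * b h)"
  then have nonneg: "\<And>h. h \<in> H \<Longrightarrow> 0 \<le> a h \<Longrightarrow> 0 \<le> b h"
    and cross: "\<And>h h'. h \<in> H \<Longrightarrow> h' \<in> H \<Longrightarrow> 0 < a h \<Longrightarrow> a h' < 0 \<Longrightarrow>
      0 \<le> a h * b h' - a h' * b h" by auto
  define S where "S = insert 0 ((\<lambda>h. b h / a h) ` {h\<in>H. a h < 0})"
  define l where "l = Max S"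
  have S: "finite S" "S \<noteq> {}" using assms by (auto simp: S_def)
  have "0 \<le> l" unfolding l_def using S by (intro Max_ge) (auto simp: S_def)
  moreover have "l * a h \<le> b h" if h: "h \<in> H" for h
  proof -
    consider "a h < 0" | "a h = 0" | "0 < a h" by linarith
    then show ?thesis
    proof cases
      case 1
      then have "b h / a h \<le> l" unfolding l_def using S h by (intro Max_ge) (auto simp: S_def)
      then show ?thesis using 1 by (simp add: neg_divide_le_eq)
    next
      case 2
      then show ?thesis using nonneg[OF h] by simp
    next
      case 3
      have "l \<in> S" unfolding l_def using S by (rule Max_in)
      then have "l \<le> b h / a h"
        using nonneg[OF h] 3 cross[OF h _ 3] by (auto simp: S_def field_simps)
      then show ?thesis using 3 by (simp add: pos_le_divide_eq)
    qed
  qed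
  ultimately show "\<exists>l\<ge>0. \<forall>h\<in>H. l * a h \<le> b h" by blast
qed

text \<open>The generators are integral, and elimination combines inequalities with integral multipliers only.
Thus the functionals are integral although the cone is real; Dickson's lemma needs this.\<close>

lemma cone_is_polyhedral:
  fixes g :: "nat \<Rightarrow> nat \<Rightarrow> int"
  shows "\<exists>H. finite H \<and> (\<forall>y :: nat \<Rightarrow> real.
    (\<exists>c. (\<forall>x<k. 0 \<le> c x) \<and> (\<forall>i<N. y i = (\<Sum>x<k. c x * of_int (g x i)))) \<longleftrightarrow>
    (\<forall>h\<in>H. 0 \<le> (\<Sum>i<N. of_int (h i :: int) * y i)))"
proof (induction k)
  case 0
  \<comment> \<open>The cone without generators is \<open>{0}\<close>, described by the inequalities \<open>y i \<ge> 0\<close> and \<open>- y i \<ge> 0\<close>.\<close>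
  define H where "H = (\<lambda>(j, s) i. if i = j then s else 0 :: int) ` ({..<N} \<times> {1, -1})"
  have sums: "(\<Sum>i<N. of_int (if i = j then s else 0) * y i) = of_int s * y j"
    if "j < N" for j :: nat and s :: int and y :: "nat \<Rightarrow> real"
  proof -
    have "(\<Sum>i<N. of_int (if i = j then s else 0) * y i) = (\<Sum>i<N. if i = j then of_int s * y i else 0)"
      by (intro sum.cong) auto
    then show ?thesis using that by simp
  qed
  have "(\<forall>h\<in>H. 0 \<le> (\<Sum>i<N. of_int (h i) * y i)) \<longleftrightarrow> (\<forall>i<N. y i = 0)" for y :: "nat \<Rightarrow> real"
    unfolding H_def by (auto simp: sums intro: antisym)
  moreover have "finite H" unfolding H_def by simp
  ultimately show ?case by (intro exI[of _ H]) auto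
next
  case (Suc k)
  then obtain H where H: "finite H" "\<And>y :: nat \<Rightarrow> real.
    (\<exists>c. (\<forall>x<k. 0 \<le> c x) \<and> (\<forall>i<N. y i = (\<Sum>x<k. c x * of_int (g x i)))) \<longleftrightarrow>
    (\<forall>h\<in>H. 0 \<le> (\<Sum>i<N. of_int (h i :: int) * y i))" by blast
  define a where "a h = (\<Sum>i<N. h i * g k i)" for h :: "nat \<Rightarrow> int"
  define b where "b y h = (\<Sum>i<N. of_int (h i :: int) * y i)" for y :: "nat \<Rightarrow> real" and h
  define H' where "H' = {h\<in>H. 0 \<le> a h} \<union>
    {(\<lambda>i. a h * h' i - a h' * h i) | h h'. h \<in> H \<and> h' \<in> H \<and> 0 < a h \<and> a h' < 0}"
  have ab: "b (\<lambda>i. y i - l * of_int (g k i)) h = b y h - l * of_int (a h)" for y l h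
    by (simp add: a_def b_def right_diff_distrib sum_subtractf sum_distrib_left ac_simps)
  have comb: "b y (\<lambda>i. a h * h' i - a h' * h i) = of_int (a h) * b y h' - of_int (a h') * b y h" for y h h'
    by (simp add: b_def algebra_simps sum_subtractf sum_distrib_left)
  have "(\<exists>c. (\<forall>x<Suc k. 0 \<le> c x) \<and> (\<forall>i<N. y i = (\<Sum>x<Suc k. c x * of_int (g x i)))) \<longleftrightarrow>
    (\<forall>h\<in>H'. 0 \<le> b y h)" for y
  proof -
    have "(\<exists>c. (\<forall>x<Suc k. 0 \<le> c x) \<and> (\<forall>i<N. y i = (\<Sum>x<Suc k. c x * of_int (g x i)))) \<longleftrightarrow>
      (\<exists>l\<ge>0. \<exists>c. (\<forall>x<k. 0 \<le> c x) \<and>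
        (\<forall>i<N. y i - l * of_int (g k i) = (\<Sum>x<k. c x * of_int (g x i))))" (is "?L = ?R")
    proof
      assume ?L
      then obtain c where c: "\<forall>x<Suc k. 0 \<le> c x" "\<forall>i<N. y i = (\<Sum>x<Suc k. c x * of_int (g x i))" by blast
      show ?R by (rule exI[of _ "c k"], intro conjI exI[of _ c]) (use c in auto)
    next
      assume ?R
      then obtain l c where lc: "0 \<le> l" "\<forall>x<k. 0 \<le> c x"
        "\<forall>i<N. y i - l * of_int (g k i) = (\<Sum>x<k. c x * of_int (g x i))" by blast
      have "(\<Sum>x<k. (c(k := l)) x * of_int (g x i)) = (\<Sum>x<k. c x * of_int (g x i))" for i
        by (intro sum.cong) auto
      then have "\<forall>i<N. y i = (\<Sum>x<Suc k. (c(k := l)) x * of_int (g x i))" using lc(3) by auto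
      moreover have "\<forall>x<Suc k. 0 \<le> (c(k := l)) x" using lc(1,2) by (auto simp: less_Suc_eq)
      ultimately show ?L by blast
    qed
    also have "\<dots> \<longleftrightarrow> (\<exists>l\<ge>0. \<forall>h\<in>H. l * of_int (a h) \<le> b y h)"
      unfolding H(2) b_def[symmetric] ab by simp
    also have "\<dots> \<longleftrightarrow> (\<forall>h\<in>H. 0 \<le> a h \<longrightarrow> 0 \<le> b y h) \<and> (\<forall>h\<in>H. \<forall>h'\<in>H.
        0 < a h \<longrightarrow> a h' < 0 \<longrightarrow> 0 \<le> b y (\<lambda>i. a h * h' i - a h' * h i))"
      unfolding bounded_multiplier_exists_iff[OF H(1)] comb by simp
    also have "\<dots> \<longleftrightarrow> (\<forall>h\<in>H'. 0 \<le> b y h)"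
      unfolding H'_def by blast
    finally show ?thesis .
  qed
  moreover have "finite H'"
  proof -
    have "H' \<subseteq> H \<union> (\<lambda>(h, h') i. a h * h' i - a h' * h i) ` (H \<times> H)"
      unfolding H'_def by auto
    then show ?thesis using H(1) by (rule finite_subset[OF _ finite_UnI]) (simp add: H(1))
  qed
  ultimately show ?case unfolding b_def by blast
qed

section \<open>Graded items from a matrix with normal semigroup\<close>

lemma weight_eq_sum_count:
  assumes "finite X" "set_mset V \<subseteq> X"
  shows "weight f V = (\<Sum>x\<in>X. f x * int (count V x))"
  using assms(2)
proof (induction V)
  case (add v V)
  have "(\<Sum>x\<in>X. f x * int (count (add_mset v V) x)) =
      (\<Sum>x\<in>X. f x * int (count V x) + (if x = v then f x else 0))"
    by (intro sum.cong) (auto simp: algebra_simps)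
  also have "\<dots> = (\<Sum>x\<in>X. f x * int (count V x)) + f v"
    using add.prems assms(1) by (simp add: sum.distrib)
  finally show ?case using add by simp
qed simp

lemma mult_mat_vec_index:
  assumes "i < dim_row M" "dim_vec c = dim_col M"
  shows "(M *\<^sub>v c) $ i = (\<Sum>x<dim_col M. M $$ (i, x) * c $ x)"
  using assms by (simp add: scalar_prod_def atLeast0LessThan)

lemma extend_by_grading_dims [simp]:
  "dim_row (extend_by_grading B t \<phi>) = dim_row B + t"
  "dim_col (extend_by_grading B t \<phi>) = dim_col B"
  by (simp_all add: extend_by_grading_def)

lemma extend_by_grading_index:
  assumes "i < dim_row B + t" "x < dim_col B"
  shows "extend_by_grading B t \<phi> $$ (i, x) =
    (if i < dim_row B then B $$ (i, x) else of_bool (\<phi> x = i - dim_row B))"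
proof -
  let ?P = "index_map_mat (dim_col B) t \<phi>"
  have P: "dim_row ?P = t" "dim_col ?P = dim_col B" by (simp_all add: index_map_mat_def)
  have "(?P *\<^sub>v unit_vec (dim_col B) x) $ j = of_bool (\<phi> x = j)" if j: "j < t" for j
  proof -
    have "(?P *\<^sub>v unit_vec (dim_col B) x) $ j = (\<Sum>y<dim_col B. ?P $$ (j, y) * unit_vec (dim_col B) x $ y)"
      using j P by (subst mult_mat_vec_index) auto
    also have "\<dots> = (\<Sum>y<dim_col B. if y = x then ?P $$ (j, y) else 0)"
      using assms(2) by (intro sum.cong) (auto simp: unit_vec_def)
    also have "\<dots> = ?P $$ (j, x)" using assms(2) by simp
    also have "\<dots> = of_bool (\<phi> x = j)"
      using j assms(2) by (auto simp: index_map_mat_def mat_of_cols_index unit_vec_def)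
    finally show ?thesis .
  qed
  then show ?thesis using assms P
    by (auto simp: extend_by_grading_def mat_of_cols_index)
qed

lemma weight_extend_by_grading:
  assumes "i < dim_row B + t" "set_mset V \<subseteq> {..<dim_col B}"
  shows "weight (\<lambda>x. extend_by_grading B t \<phi> $$ (i, x)) V =
    (if i < dim_row B then weight (\<lambda>x. B $$ (i, x)) V
     else int (count (image_mset \<phi> V) (i - dim_row B)))"
  using assms(2)
proof (induction V)
  case (add x V)
  then show ?case using extend_by_grading_index[OF assms(1), of x] by auto
qed simp

lemma weight_linear_combination:
  "weight (\<lambda>x. \<Sum>i<N. h i * f i x) V = (\<Sum>i<N. h i * weight (f i) V)"
  by (induction V) (simp_all add: sum.distrib distrib_left)

lemma normal_graded_items_of_matrix:
  assumes B: "B \<in> carrier_mat m n" and \<phi>: "\<phi> ` {..<n} \<subseteq> {..<t}"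
    and normal: "normal_semigroup (extend_by_grading B t \<phi>)"
  shows "\<exists>K. normal_graded_items {..<n} {..<m} (\<lambda>i x. B $$ (i, x)) \<phi> K"
proof -
  interpret graded_items "{..<n}" "{..<m}" "\<lambda>i x. B $$ (i, x)" \<phi>
    by unfold_locales simp
  define M where "M = extend_by_grading B t \<phi>"
  have dims: "dim_row B = m" "dim_col B = n" using B by auto
  have Mdims: "dim_row M = m + t" "dim_col M = n" by (simp_all add: M_def dims)
  define f where "f i x = M $$ (i, x)" for i x
  have weight_f: "weight (f i) V = (if i < m then weight (\<lambda>x. B $$ (i, x)) V
      else int (count (image_mset \<phi> V) (i - m)))" if "i < m + t" "set_mset V \<subseteq> {..<n}" for i V
    using weight_extend_by_grading[of i B t V \<phi>] that unfolding f_def M_def dims by simp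
  obtain H where H: "finite H" "\<And>y :: nat \<Rightarrow> real.
    (\<exists>c. (\<forall>x<n. 0 \<le> c x) \<and> (\<forall>i<m+t. y i = (\<Sum>x<n. c x * of_int (f i x)))) \<longleftrightarrow>
    (\<forall>h\<in>H. 0 \<le> (\<Sum>i<m+t. of_int (h i :: int) * y i))"
    using cone_is_polyhedral[of n "m + t" "\<lambda>x i. f i x"] by blast
  define K where "K = (\<lambda>h x. \<Sum>i<m+t. h i * f i x) ` H"
  have "normal_graded_items {..<n} {..<m} (\<lambda>i x. B $$ (i, x)) \<phi> K"
  proof
    show "finite K" using H(1) by (simp add: K_def)
  next
    fix \<kappa> x assume "\<kappa> \<in> K" and x: "x \<in> {..<n}"
    then obtain h where h: "h \<in> H" "\<kappa> = (\<lambda>x. \<Sum>i<m+t. h i * f i x)" by (auto simp: K_def)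
    have "\<exists>c :: nat \<Rightarrow> real. (\<forall>z<n. 0 \<le> c z) \<and>
        (\<forall>i<m+t. real_of_int (f i x) = (\<Sum>z<n. c z * of_int (f i z)))"
    proof (intro exI[of _ "\<lambda>z. of_bool (z = x)"] conjI allI impI)
      fix i
      have "(\<Sum>z<n. of_bool (z = x) * real_of_int (f i z)) = (\<Sum>z<n. if z = x then real_of_int (f i z) else 0)"
        by (intro sum.cong) auto
      then show "real_of_int (f i x) = (\<Sum>z<n. of_bool (z = x) * real_of_int (f i z))" using x by simp
    qed simp
    then have "0 \<le> (\<Sum>i<m+t. real_of_int (h i) * real_of_int (f i x))" using H(2)[of "\<lambda>i. real_of_int (f i x)"] h(1) by blast
    then have "0 \<le> real_of_int (\<kappa> x)" by (simp add: h(2))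
    then show "0 \<le> \<kappa> x" by simp
  next
    fix \<kappa> P Q
    assume "\<kappa> \<in> K" and PQ: "set_mset P \<subseteq> {..<n}" "set_mset Q \<subseteq> {..<n}" "equiv_items P Q"
      "image_mset \<phi> P = image_mset \<phi> Q"
    then obtain h where h: "\<kappa> = (\<lambda>x. \<Sum>i<m+t. h i * f i x)" by (auto simp: K_def)
    show "weight \<kappa> P = weight \<kappa> Q"
      unfolding h weight_linear_combination
      by (intro sum.cong refl) (use PQ in \<open>auto simp: weight_f equiv_items_def\<close>)
  next
    fix P Q
    assume P: "set_mset P \<subseteq> {..<n}" and Q: "set_mset Q \<subseteq> {..<n}"
      and le: "\<And>\<kappa>. \<kappa> \<in> K \<Longrightarrow> weight \<kappa> P \<le> weight \<kappa> Q"
    \<comment> \<open>\<open>z\<close> is the lattice point represented by \<open>Q\<close> minus \<open>P\<close>.\<close>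
    define c where "c = vec n (\<lambda>x. int (count Q x) - int (count P x))"
    define z where "z = M *\<^sub>v c"
    have z: "z $ i = weight (f i) Q - weight (f i) P" if "i < m + t" for i
    proof -
      have "z $ i = (\<Sum>x<n. f i x * (int (count Q x) - int (count P x)))"
        using that Mdims unfolding z_def f_def by (subst mult_mat_vec_index) (auto simp: c_def)
      also have "\<dots> = weight (f i) Q - weight (f i) P"
        using P Q by (simp add: weight_eq_sum_count[of "{..<n}"] right_diff_distrib sum_subtractf)
      finally show ?thesis .
    qed
    have "\<forall>h\<in>H. 0 \<le> (\<Sum>i<m+t. of_int (h i) * real_of_int (z $ i))"
    proof
      fix h assume "h \<in> H"
      then have "weight (\<lambda>x. \<Sum>i<m+t. h i * f i x) P \<le> weight (\<lambda>x. \<Sum>i<m+t. h i * f i x) Q"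
        using le by (simp add: K_def)
      then have "0 \<le> (\<Sum>i<m+t. h i * z $ i)"
        unfolding weight_linear_combination by (simp add: z right_diff_distrib sum_subtractf)
      moreover have "(\<Sum>i<m+t. of_int (h i) * real_of_int (z $ i)) = real_of_int (\<Sum>i<m+t. h i * z $ i)"
        by simp
      ultimately show "0 \<le> (\<Sum>i<m+t. of_int (h i) * real_of_int (z $ i))"
        by (simp only: of_int_0_le_iff)
    qed
    then obtain e :: "nat \<Rightarrow> real" where e: "\<forall>x<n. 0 \<le> e x"
      "\<forall>i<m+t. real_of_int (z $ i) = (\<Sum>x<n. e x * of_int (f i x))"
      using H(2)[of "\<lambda>i. real_of_int (z $ i)"] by blast
    have "map_vec real_of_int z = map_mat real_of_int M *\<^sub>v vec n e"
    proof (rule eq_vecI)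
      fix i assume "i < dim_vec (map_mat real_of_int M *\<^sub>v vec n e)"
      then have i: "i < m + t" using Mdims by simp
      have "(map_mat real_of_int M *\<^sub>v vec n e) $ i = (\<Sum>x<n. real_of_int (f i x) * e x)"
        using i Mdims by (subst mult_mat_vec_index) (auto simp: f_def)
      also have "\<dots> = real_of_int (z $ i)" using e(2) i by (simp add: mult.commute)
      finally show "map_vec real_of_int z $ i = (map_mat real_of_int M *\<^sub>v vec n e) $ i"
        using i Mdims by (simp add: z_def)
    qed (simp add: z_def)
    moreover have "0\<^sub>v n \<le> vec n e" using e(1) by (simp add: less_eq_vec_def)
    ultimately have "map_vec real_of_int z \<in> cone_of M"
      unfolding cone_of_def using Mdims by auto
    moreover have "z \<in> col_lattice M"
      unfolding col_lattice_def z_def c_def using Mdims by auto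
    ultimately have "z \<in> semigroup_of M" using normal unfolding normal_semigroup_def M_def by blast
    then obtain d where d: "d \<in> carrier_vec n" "0\<^sub>v n \<le> d" "z = M *\<^sub>v d"
      unfolding semigroup_of_def using Mdims by auto
    define R where "R = (\<Sum>x<n. replicate_mset (nat (d $ x)) x)"
    have count_R: "count R x = (if x < n then nat (d $ x) else 0)" for x
      by (auto simp: R_def count_sum)
    have R: "set_mset R \<subseteq> {..<n}"
    proof
      fix x assume "x \<in># R"
      then have "count R x \<noteq> 0" by simp
      then show "x \<in> {..<n}" unfolding count_R by (simp split: if_splits)
    qed
    have sum_f: "weight (f i) Q = weight (f i) (P + R)" if i: "i < m + t" for i
    proof -
      have "weight (f i) R = (\<Sum>x<n. f i x * d $ x)"
        using R d(1,2) by (simp add: weight_eq_sum_count[of "{..<n}"] count_R less_eq_vec_def)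
      also have "\<dots> = z $ i"
        using i d(1) Mdims unfolding d(3) f_def by (subst mult_mat_vec_index) auto
      finally show ?thesis using z[OF i] by simp
    qed
    have PR: "set_mset (P + R) \<subseteq> {..<n}" using P R by simp
    have "equiv_items Q (P + R)"
      unfolding equiv_items_def
    proof
      fix i assume i: "i \<in> {..<m}"
      then show "weight (\<lambda>x. B $$ (i, x)) Q = weight (\<lambda>x. B $$ (i, x)) (P + R)"
        using sum_f[of i] weight_f[of i, OF _ Q] weight_f[of i, OF _ PR] by simp
    qed
    moreover have "image_mset \<phi> Q = image_mset \<phi> (P + R)"
    proof (rule multiset_eqI)
      fix a
      show "count (image_mset \<phi> Q) a = count (image_mset \<phi> (P + R)) a"
      proof (cases "a < t")
        case True
        then show ?thesis
          using sum_f[of "m + a"] weight_f[of "m + a", OF _ Q] weight_f[of "m + a", OF _ PR] by simp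
      next
        case False
        have "a \<notin># image_mset \<phi> V" if "set_mset V \<subseteq> {..<n}" for V
          using that False \<phi> by auto
        then show ?thesis using Q PR by (metis count_eq_zero_iff)
      qed
    qed
    ultimately show "\<exists>R. set_mset R \<subseteq> {..<n} \<and> equiv_items Q (P + R) \<and>
        image_mset \<phi> Q = image_mset \<phi> (P + R)" using R by blast
  qed
  then show ?thesis by blast
qed

section \<open>Tables as points in the fibers of a toric fiber power\<close>

lemma stacked_cols_dim [simp]: "dim_vec (stacked_cols B \<rho>) = length \<rho> * dim_row B"
  by (induction \<rho>) (simp_all add: stacked_cols_def)

lemma stacked_cols_index:
  assumes "j < length \<rho>" "i < dim_row B"
  shows "stacked_cols B \<rho> $ (j * dim_row B + i) = col B (\<rho> ! j) $ i"
  using assms(1)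
proof (induction \<rho> arbitrary: j)
  case (Cons x \<rho>)
  have Cons_eq: "stacked_cols B (x # \<rho>) = col B x @\<^sub>v stacked_cols B \<rho>"
    by (simp add: stacked_cols_def)
  show ?case
  proof (cases j)
    case 0
    then show ?thesis using assms(2) by (simp add: Cons_eq)
  next
    case (Suc j')
    have "(j' + 1) * dim_row B \<le> length \<rho> * dim_row B"
      using Cons.prems Suc by (intro mult_le_mono1) simp
    then have "j' * dim_row B + i < length \<rho> * dim_row B" using assms(2) by simp
    then show ?thesis using Cons.IH[of j'] Cons.prems Suc by (simp add: Cons_eq)
  qed
qed simp

lemma set_fiber_tuples: "set (fiber_tuples r n \<phi>) = {\<rho>. graded_items.monochrome {..<n} \<phi> r \<rho>}"
proof -
  \<comment> \<open>The notion of a monochrome row involves no matrix, so a matrix without rows serves here.\<close>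
  interpret graded_items "{..<n}" "{}" "\<lambda>(_ :: nat) _. 0" \<phi>
    by unfold_locales simp
  have "(length \<rho> = r \<and> set \<rho> \<subseteq> {..<n} \<and> (\<forall>x\<in>set \<rho>. \<forall>y\<in>set \<rho>. \<phi> x = \<phi> y)) \<longleftrightarrow> monochrome r \<rho>" for \<rho>
  proof
    assume l: "length \<rho> = r \<and> set \<rho> \<subseteq> {..<n} \<and> (\<forall>x\<in>set \<rho>. \<forall>y\<in>set \<rho>. \<phi> x = \<phi> y)"
    have "\<rho> ! i \<in> {..<n} \<and> \<phi> (\<rho> ! i) = \<phi> (hd \<rho>)" if "i < r" for i
    proof -
      have "\<rho> ! i \<in> set \<rho>" using l that by (intro nth_mem) simp
      moreover from this have "hd \<rho> \<in> set \<rho>" by (cases \<rho>) simp_all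
      ultimately show ?thesis using l by blast
    qed
    then show "monochrome r \<rho>" using l unfolding monochrome_def by blast
  next
    assume m: "monochrome r \<rho>"
    have "x \<in> {..<n} \<and> \<phi> x = \<phi> (\<rho> ! 0)" if x: "x \<in> set \<rho>" for x
    proof -
      obtain i where "i < r" "x = \<rho> ! i" using x monochromeD(1)[OF m] by (auto simp: in_set_conv_nth)
      then show ?thesis using monochromeD(2,3)[OF m, of i] by simp
    qed
    then show "length \<rho> = r \<and> set \<rho> \<subseteq> {..<n} \<and> (\<forall>x\<in>set \<rho>. \<forall>y\<in>set \<rho>. \<phi> x = \<phi> y)"
      using monochromeD(1)[OF m] by auto
  qed
  then show ?thesis by (auto simp: fiber_tuples_def set_n_lists atLeast0LessThan)
qed

lemma distinct_fiber_tuples: "distinct (fiber_tuples r n \<phi>)"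
  unfolding fiber_tuples_def by (intro distinct_filter distinct_n_lists) simp

lemma toric_fiber_power_dims [simp]:
  "dim_row (toric_fiber_power r B \<phi>) = r * dim_row B"
  "dim_col (toric_fiber_power r B \<phi>) = length (fiber_tuples r (dim_col B) \<phi>)"
  by (simp_all add: toric_fiber_power_def)

definition count_vec :: "'a list \<Rightarrow> 'a multiset \<Rightarrow> int vec" where
  "count_vec xs T = vec (length xs) (\<lambda>a. int (count T (xs ! a)))"

lemma count_vec_carrier: "count_vec xs T \<in> carrier_vec (length xs)" "0\<^sub>v (length xs) \<le> count_vec xs T"
  by (simp_all add: count_vec_def less_eq_vec_def)

lemma sum_count_nth_le_size:
  assumes "distinct xs"
  shows "(\<Sum>a<length xs. count T (xs ! a)) \<le> size T"
proof -
  have "(\<Sum>a<length xs. count T (xs ! a)) = (\<Sum>x\<in>set xs. count T x)"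
    by (rule sum.reindex_bij_betw[OF bij_betw_nth[OF assms refl refl]])
  also have "\<dots> = (\<Sum>x\<in>set xs \<inter> set_mset T. count T x)"
    by (rule sum.mono_neutral_right) (auto simp: count_eq_zero_iff)
  also have "\<dots> \<le> (\<Sum>x\<in>set_mset T. count T x)"
    by (rule sum_mono2) auto
  also have "\<dots> = size T" by (simp add: size_multiset_overloaded_eq)
  finally show ?thesis .
qed

text \<open>The common part \<open>Z\<close> cancels, so the positive part of the difference is dominated by \<open>U\<close> and the
negative part by \<open>U'\<close>.\<close>

lemma move_degree_count_vec_diff:
  assumes "distinct xs" "size U \<le> d" "size U' \<le> d"
  shows "move_degree (count_vec xs (Z + U) - count_vec xs (Z + U')) \<le> d"
proof -
  have bound: "one_norm w \<le> d"
    if "dim_vec w = length xs" "\<And>a. a < length xs \<Longrightarrow> \<bar>w $ a\<bar> \<le> int (count S (xs ! a))" "size S \<le> d"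
    for w S
  proof -
    have "(\<Sum>a<dim_vec w. \<bar>w $ a\<bar>) \<le> (\<Sum>a<length xs. int (count S (xs ! a)))"
      unfolding that(1) by (rule sum_mono) (use that(2) in auto)
    also have "\<dots> = int (\<Sum>a<length xs. count S (xs ! a))" by simp
    also have "\<dots> \<le> int d" using sum_count_nth_le_size[OF assms(1), of S] that(3) by linarith
    finally show ?thesis by (simp add: one_norm_def)
  qed
  have "one_norm (pos_part (count_vec xs (Z + U) - count_vec xs (Z + U'))) \<le> d"
    by (rule bound[OF _ _ assms(2)]) (auto simp: pos_part_def count_vec_def)
  moreover have "one_norm (neg_part (count_vec xs (Z + U) - count_vec xs (Z + U'))) \<le> d"
    by (rule bound[OF _ _ assms(3)]) (auto simp: neg_part_def count_vec_def)
  ultimately show ?thesis by (simp add: move_degree_def)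
qed

lemma count_vec_surj:
  assumes "u \<in> carrier_vec (length xs)" "0\<^sub>v (length xs) \<le> u" "distinct xs"
  shows "\<exists>T. set_mset T \<subseteq> set xs \<and> count_vec xs T = u"
proof -
  define T where "T = (\<Sum>a<length xs. replicate_mset (nat (u $ a)) (xs ! a))"
  have "count T (xs ! a) = nat (u $ a)" if a: "a < length xs" for a
  proof -
    have "count T (xs ! a) = (\<Sum>b<length xs. if b = a then nat (u $ b) else 0)"
      unfolding T_def count_sum using a assms(3)
      by (intro sum.cong) (auto simp: nth_eq_iff_index_eq)
    then show ?thesis using a by simp
  qed
  then have "count_vec xs T = u"
    using assms(1,2) by (intro eq_vecI) (auto simp: count_vec_def less_eq_vec_def)
  moreover have "set_mset T \<subseteq> set xs"
  proof
    fix x assume "x \<in># T"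
    then obtain a where "a < length xs" "x \<in># replicate_mset (nat (u $ a)) (xs ! a)"
      unfolding T_def by (auto simp: set_mset_sum)
    then show "x \<in> set xs" by (auto split: if_splits)
  qed
  ultimately show ?thesis by blast
qed

text \<open>Moves outside the kernel are harmless in a Markov basis, since they join no two points of a fiber.
Therefore one can test the set of all vectors of bounded degree.\<close>

lemma mardeg_le_if_markov_basis:
  assumes "markov_basis M {z \<in> carrier_vec (dim_col M). move_degree z \<le> d}"
  shows "mardeg M \<le> enat d"
proof -
  have "mardeg M \<le> set_degree {z \<in> carrier_vec (dim_col M). move_degree z \<le> d}"
    unfolding mardeg_def by (rule INF_lower) (use assms in simp)
  also have "\<dots> \<le> enat d" unfolding set_degree_def by (rule SUP_least) simp
  finally show ?thesis .
qed

theorem corollary53: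
  fixes A B :: "int mat" and \<phi> :: "nat \<Rightarrow> nat" and s t m n :: nat
  assumes "A \<in> carrier_mat s t"
    and "B \<in> carrier_mat m n"
    and "\<phi> ` {..<n} = {..<t}"
    and "graded_by A B \<phi>"
    and "normal_semigroup (extend_by_grading B t \<phi>)"
  shows "(SUP r\<in>{1..}. mardeg (toric_fiber_power r B \<phi>)) < \<infinity>"
proof -
  obtain K where "normal_graded_items {..<n} {..<m} (\<lambda>i x. B $$ (i, x)) \<phi> K"
    using normal_graded_items_of_matrix[OF assms(2) equalityD1[OF assms(3)] assms(5)] by blast
  then interpret normal_graded_items "{..<n}" "{..<m}" "\<lambda>i x. B $$ (i, x)" \<phi> K .
  have dims: "dim_row B = m" "dim_col B = n" using assms(2) by auto
  obtain d where "\<forall>r>0. \<forall>T T'. table r T \<longrightarrow> table r T' \<longrightarrow>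
     (\<forall>j<r. equiv_items (margin j T) (margin j T')) \<longrightarrow> connected_by r d T T'"
    using connected_by_equiv_margins by (rule exE)
  note d = this[rule_format]
  have "mardeg (toric_fiber_power r B \<phi>) \<le> enat d" if r: "0 < r" for r
  proof (rule mardeg_le_if_markov_basis)
    define M where "M = toric_fiber_power r B \<phi>"
    define ft where "ft = fiber_tuples r n \<phi>"
    define S where "S = {z \<in> carrier_vec (dim_col M). move_degree z \<le> d}"
    have Mdims: "dim_row M = r * m" "dim_col M = length ft" by (simp_all add: M_def ft_def dims)
    have dist: "distinct ft" unfolding ft_def by (rule distinct_fiber_tuples)
    have set_ft: "set ft = {\<rho>. monochrome r \<rho>}" unfolding ft_def by (rule set_fiber_tuples)
    have entry: "(M *\<^sub>v count_vec ft T) $ (j * m + i) = weight (\<lambda>x. B $$ (i, x)) (margin j T)"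
      if T: "table r T" and j: "j < r" and i: "i < m" for T j i
    proof -
      have lt: "j * m + i < r * m"
      proof -
        have "(j + 1) * m \<le> r * m" using j by (intro mult_le_mono1) simp
        then show ?thesis using i by simp
      qed
      have M_entry: "M $$ (j * m + i, a) = B $$ (i, ft ! a ! j)" if a: "a < length ft" for a
      proof -
        have mono: "monochrome r (ft ! a)" using nth_mem[OF a] set_ft by simp
        have "M $$ (j * m + i, a) = stacked_cols B (ft ! a) $ (j * m + i)"
          using a lt by (simp add: M_def toric_fiber_power_def ft_def dims mat_of_cols_index)
        also have "\<dots> = col B (ft ! a ! j) $ i"
          using stacked_cols_index[of j "ft ! a" i B] monochromeD(1)[OF mono] i j by (simp add: dims)
        also have "\<dots> = B $$ (i, ft ! a ! j)"
          using monochromeD(2)[OF mono j] i by (simp add: dims)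
        finally show ?thesis .
      qed
      have "(M *\<^sub>v count_vec ft T) $ (j * m + i)
          = (\<Sum>a<length ft. B $$ (i, ft ! a ! j) * int (count T (ft ! a)))"
        using lt Mdims M_entry by (subst mult_mat_vec_index) (auto simp: count_vec_def)
      also have "\<dots> = (\<Sum>\<rho>\<in>set ft. B $$ (i, \<rho> ! j) * int (count T \<rho>))"
        by (rule sum.reindex_bij_betw[OF bij_betw_nth[OF dist refl refl]])
      also have "\<dots> = weight (\<lambda>\<rho>. B $$ (i, \<rho> ! j)) T"
        by (rule weight_eq_sum_count[OF finite_set, symmetric]) (use T set_ft in \<open>auto simp: table_def\<close>)
      also have "\<dots> = weight (\<lambda>x. B $$ (i, x)) (margin j T)"
        by (simp add: margin_def image_mset.compositionality o_def)
      finally show ?thesis .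
    qed
    have same_value: "M *\<^sub>v count_vec ft T = M *\<^sub>v count_vec ft T' \<longleftrightarrow>
        (\<forall>j<r. equiv_items (margin j T) (margin j T'))" if T: "table r T" "table r T'" for T T'
    proof
      assume eq: "M *\<^sub>v count_vec ft T = M *\<^sub>v count_vec ft T'"
      show "\<forall>j<r. equiv_items (margin j T) (margin j T')"
        unfolding equiv_items_def
      proof (intro allI impI ballI)
        fix j i assume j: "j < r" and "i \<in> {..<m}"
        then have i: "i < m" by simp
        show "weight (\<lambda>x. B $$ (i, x)) (margin j T) = weight (\<lambda>x. B $$ (i, x)) (margin j T')"
          unfolding entry[OF T(1) j i, symmetric] entry[OF T(2) j i, symmetric] eq ..
      qed
    next
      assume eq: "\<forall>j<r. equiv_items (margin j T) (margin j T')"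
      show "M *\<^sub>v count_vec ft T = M *\<^sub>v count_vec ft T'"
      proof (rule eq_vecI)
        fix l assume "l < dim_vec (M *\<^sub>v count_vec ft T')"
        then have l: "l < r * m" using Mdims by simp
        then have "0 < m" by (cases m) auto
        then have ij: "l div m < r" "l mod m < m" using l by (auto simp: less_mult_imp_div_less)
        have "(M *\<^sub>v count_vec ft T) $ (l div m * m + l mod m)
            = (M *\<^sub>v count_vec ft T') $ (l div m * m + l mod m)"
          unfolding entry[OF T(1) ij] entry[OF T(2) ij]
          using eq ij by (auto simp: equiv_items_def)
        then show "(M *\<^sub>v count_vec ft T) $ l = (M *\<^sub>v count_vec ft T') $ l" by simp
      qed simp
    qed
    have path: "(count_vec ft T, count_vec ft T') \<in> (fiber_edges M (M *\<^sub>v count_vec ft T) S)\<^sup>*"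
      if con: "connected_by r d T T'" and T: "table r T" for T T'
      using con
    proof (induction rule: rtranclp_induct)
      case (step Y Y')
      have Yt: "table r Y" using connected_by_table[OF step.hyps(1) T] .
      have con': "connected_by r d T Y'" using step.hyps by simp
      have Yt': "table r Y'" using connected_by_table[OF con' T] .
      have "M *\<^sub>v count_vec ft Y = M *\<^sub>v count_vec ft T"
        using same_value[OF T Yt] connected_by_equiv[OF step.hyps(1)] by simp
      moreover have "M *\<^sub>v count_vec ft Y' = M *\<^sub>v count_vec ft T"
        using same_value[OF T Yt'] connected_by_equiv[OF con'] by simp
      moreover have "count_vec ft Y - count_vec ft Y' \<in> S"
      proof -
        obtain Z U U' where ZU: "Y = Z + U" "Y' = Z + U'" "size U \<le> d" "size U' \<le> d"
          using step.hyps(2) unfolding step_def by blast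
        show ?thesis using move_degree_count_vec_diff[OF dist ZU(3,4)] Mdims count_vec_carrier(1)
          unfolding S_def ZU(1,2) by (auto simp: count_vec_def)
      qed
      ultimately have "(count_vec ft Y, count_vec ft Y') \<in> fiber_edges M (M *\<^sub>v count_vec ft T) S"
        using count_vec_carrier[of ft] Mdims by (simp add: fiber_edges_def fiber_def)
      then show ?case using step.IH by (rule rtrancl_into_rtrancl[rotated])
    qed simp
    have "(u, v) \<in> (fiber_edges M b S)\<^sup>*" if u: "u \<in> fiber M b" and v: "v \<in> fiber M b" for b u v
    proof -
      obtain T where T: "set_mset T \<subseteq> set ft" "count_vec ft T = u"
        using count_vec_surj[of u ft] u dist Mdims by (auto simp: fiber_def)
      obtain T' where T': "set_mset T' \<subseteq> set ft" "count_vec ft T' = v"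
        using count_vec_surj[of v ft] v dist Mdims by (auto simp: fiber_def)
      have tables: "table r T" "table r T'" using T(1) T'(1) set_ft by (auto simp: table_def)
      have b: "M *\<^sub>v u = b" "M *\<^sub>v v = b" using u v by (auto simp: fiber_def)
      have "\<forall>j<r. equiv_items (margin j T) (margin j T')"
        using same_value[OF tables] T(2) T'(2) b by simp
      then have "connected_by r d T T'" using d[OF r tables] by blast
      from path[OF this tables(1)] show ?thesis unfolding T(2) T'(2) b .
    qed
    then show "markov_basis (toric_fiber_power r B \<phi>)
        {z \<in> carrier_vec (dim_col (toric_fiber_power r B \<phi>)). move_degree z \<le> d}"
      unfolding markov_basis_def S_def M_def by blast
  qed
  then have "(SUP r\<in>{1..}. mardeg (toric_fiber_power r B \<phi>)) \<le> enat d"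
    by (intro SUP_least) auto
  then show ?thesis by (rule le_less_trans) simp
qed

end
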